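(* Let $X$ be an infinite dimensional Banach space with the approximation property and $A=K(X)$. (a) If $\mathrm{wpL}(A)$ separates the points of $A$, then either $L_a$ fixes a copy of $\ell^1$ for every nonzero $a\in A$, or $R_a$ fixes a copy of $\ell^1$ for every nonzero $a\in A$. (b) If $\mathrm{lcc}(A)$ (resp. $\mathrm{rcc}(A)$) separates the points of $A$, then $L_a$ (resp. $R_a$) fixes a copy of $\ell^1$ for every nonzero $a\in A$.
   Context: $K(X)$ is the Banach algebra of compact operators on $X$. $L_a,R_a:A\to A$ are $L_ax=ax$, $R_ax=xa$. An operator $T$ fixes a copy of $\ell^1$ if there is a subspace $Y$ isomorphic to $\ell^1$ such that $T|_Y$ is an isomorphism onto its range. For $f\in A^*$, $a\in A$: $fa(x)=f(ax)$, $af(x)=f(xa)$; $T_f(a)=fa$, $S_f(a)=af$. A set $E\subseteq A^*$ is an L-set if for every weakly null sequence $(x_n)$ in $A$, $\lim_n\sup_{g\in E}|g(x_n)|=0$. A set is weakly precompact if every sequence in it has a weakly Cauchy subsequence. $\mathrm{wpL}(A)$ is the set of $f\in A^*$ such that $T_f$ maps weakly precompact sets onto L-sets; $\mathrm{lcc}(A)$ (resp. $\mathrm{rcc}(A)$) is the set of $f$ such that $T_f$ (resp. $S_f$) is completely continuous (maps weakly null sequences to norm null sequences). A set of functionals separates points of $A$ if for each nonzero $a$ some functional in it is nonzero at $a$. *)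

theory Defs
  imports "HOL-Analysis.Analysis"
begin

text \<open>Real Banach space X = type 'a. A = K(X) is the set Kop of compact bounded operators,
 a closed subalgebra of the blinfun type (product = composition, operator norm).\<close>

definition Kop :: "('a::real_normed_vector \<Rightarrow>\<^sub>L 'a) set" where
  "Kop = {T. compact (closure (blinfun_apply T ` ball 0 1))}"

definition infinite_dim :: "'a::real_vector itself \<Rightarrow> bool" where
  "infinite_dim _ = (\<not> (\<exists>B::'a set. finite B \<and> span B = UNIV))"

definition approx_prop :: "'a::real_normed_vector itself \<Rightarrow> bool" where
  "approx_prop _ = (\<forall>C::'a set. compact C \<longrightarrow> (\<forall>e>0. \<exists>T::'a \<Rightarrow>\<^sub>L 'a.
      (\<exists>B. finite B \<and> range (blinfun_apply T) \<subseteq> span B) \<and> (\<forall>x\<in>C. norm (T x - x) \<le> e)))"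

text \<open>Dual space A^*: functions that are linear and bounded on Kop (values off Kop irrelevant).\<close>
definition dualA :: "(('a::real_normed_vector \<Rightarrow>\<^sub>L 'a) \<Rightarrow> real) set" where
  "dualA = {f. (\<forall>x\<in>Kop. \<forall>y\<in>Kop. f (x + y) = f x + f y) \<and> (\<forall>c. \<forall>x\<in>Kop. f (c *\<^sub>R x) = c * f x)
              \<and> (\<exists>C. \<forall>x\<in>Kop. \<bar>f x\<bar> \<le> C * norm x)}"

definition dual_norm :: "(('a::real_normed_vector \<Rightarrow>\<^sub>L 'a) \<Rightarrow> real) \<Rightarrow> real" where
  "dual_norm g = (SUP x\<in>{x\<in>Kop. norm x \<le> 1}. \<bar>g x\<bar>)"

definition weakly_null :: "(nat \<Rightarrow> ('a::real_normed_vector \<Rightarrow>\<^sub>L 'a)) \<Rightarrow> bool" where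
  "weakly_null s = ((\<forall>n. s n \<in> Kop) \<and> (\<forall>f\<in>dualA. (\<lambda>n. f (s n)) \<longlonglongrightarrow> 0))"

definition weakly_precompact :: "('a::real_normed_vector \<Rightarrow>\<^sub>L 'a) set \<Rightarrow> bool" where
  "weakly_precompact E = (E \<subseteq> Kop \<and> (\<forall>s. (\<forall>n. s n \<in> E) \<longrightarrow>
      (\<exists>r::nat \<Rightarrow> nat. strict_mono r \<and> (\<forall>f\<in>dualA. convergent (\<lambda>n. f (s (r n)))))))"

definition L_set :: "(('a::real_normed_vector \<Rightarrow>\<^sub>L 'a) \<Rightarrow> real) set \<Rightarrow> bool" where
  "L_set E = (\<forall>s. weakly_null s \<longrightarrow>
      (\<forall>e>0. eventually (\<lambda>n. \<forall>g\<in>E. \<bar>g (s n)\<bar> \<le> e) sequentially))"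

definition lmod :: "(('a::real_normed_vector \<Rightarrow>\<^sub>L 'a) \<Rightarrow> real) \<Rightarrow> ('a \<Rightarrow>\<^sub>L 'a) \<Rightarrow> (('a \<Rightarrow>\<^sub>L 'a) \<Rightarrow> real)" where
  "lmod f a = (\<lambda>x. f (a o\<^sub>L x))"

definition rmod :: "('a::real_normed_vector \<Rightarrow>\<^sub>L 'a) \<Rightarrow> (('a \<Rightarrow>\<^sub>L 'a) \<Rightarrow> real) \<Rightarrow> (('a \<Rightarrow>\<^sub>L 'a) \<Rightarrow> real)" where
  "rmod a f = (\<lambda>x. f (x o\<^sub>L a))"

definition wpL :: "(('a::real_normed_vector \<Rightarrow>\<^sub>L 'a) \<Rightarrow> real) set" where
  "wpL = {f\<in>dualA. \<forall>E. weakly_precompact E \<longrightarrow> L_set ((\<lambda>a. lmod f a) ` E)}"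

definition lcc :: "(('a::real_normed_vector \<Rightarrow>\<^sub>L 'a) \<Rightarrow> real) set" where
  "lcc = {f\<in>dualA. \<forall>s. weakly_null s \<longrightarrow> (\<lambda>n. dual_norm (lmod f (s n))) \<longlonglongrightarrow> 0}"

definition rcc :: "(('a::real_normed_vector \<Rightarrow>\<^sub>L 'a) \<Rightarrow> real) set" where
  "rcc = {f\<in>dualA. \<forall>s. weakly_null s \<longrightarrow> (\<lambda>n. dual_norm (rmod (s n) f)) \<longlonglongrightarrow> 0}"

definition separates :: "(('a::real_normed_vector \<Rightarrow>\<^sub>L 'a) \<Rightarrow> real) set \<Rightarrow> bool" where
  "separates S = (\<forall>a\<in>Kop. a \<noteq> 0 \<longrightarrow> (\<exists>f\<in>S. f a \<noteq> 0))"

definition l1 :: "(nat \<Rightarrow> real) set" where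
  "l1 = {x. summable (\<lambda>n. \<bar>x n\<bar>)}"

definition l1norm :: "(nat \<Rightarrow> real) \<Rightarrow> real" where
  "l1norm x = (\<Sum>n. \<bar>x n\<bar>)"

text \<open>An operator T on A fixes a copy of ell^1: there is a subspace Y = J ` l1 of A and a linear
 isomorphism J from ell^1 onto Y, such that T restricted to Y is an isomorphism onto its range
 (i.e. bounded below on Y).\<close>
definition fixes_l1 :: "(('a::real_normed_vector \<Rightarrow>\<^sub>L 'a) \<Rightarrow> ('a \<Rightarrow>\<^sub>L 'a)) \<Rightarrow> bool" where
  "fixes_l1 T = (\<exists>J c C d. (\<forall>x\<in>l1. J x \<in> Kop)
     \<and> (\<forall>x\<in>l1. \<forall>y\<in>l1. J (\<lambda>n. x n + y n) = J x + J y) \<and> (\<forall>r. \<forall>x\<in>l1. J (\<lambda>n. r * x n) = r *\<^sub>R J x)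
     \<and> c > 0 \<and> (\<forall>x\<in>l1. c * l1norm x \<le> norm (J x) \<and> norm (J x) \<le> C * l1norm x)
     \<and> d > 0 \<and> (\<forall>x\<in>l1. d * norm (J x) \<le> norm (T (J x))))"

definition Lop :: "('a::real_normed_vector \<Rightarrow>\<^sub>L 'a) \<Rightarrow> ('a \<Rightarrow>\<^sub>L 'a) \<Rightarrow> ('a \<Rightarrow>\<^sub>L 'a)" where
  "Lop a = (\<lambda>x. a o\<^sub>L x)"

definition Rop :: "('a::real_normed_vector \<Rightarrow>\<^sub>L 'a) \<Rightarrow> ('a \<Rightarrow>\<^sub>L 'a) \<Rightarrow> ('a \<Rightarrow>\<^sub>L 'a)" where
  "Rop a = (\<lambda>x. x o\<^sub>L a)"

end

theory Submission
  imports Defs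
begin

text \<open>
  Write x \<otimes> \<phi> for the rank-one operator y \<mapsto> \<phi>(y) x. For a nonzero a, the operator
  L_a maps z \<otimes> \<phi> to a(z) \<otimes> \<phi>, so a copy of l1 in X* gives one in A fixed by L_a;
  dually R_a maps y \<otimes> \<psi> to y \<otimes> (\<psi> \<circ> a), so a copy of l1 in X gives one fixed by R_a.
  If l1 does not embed in X (or X*), then Rosenthal's theorem applied to a separated bounded sequence
  and passage to differences yield a weakly null sequence of vectors of norm at least 1.
  Such a sequence in X* (in X), tensored with a fixed vector (functional), is weakly null in A
  and forces f(x \<otimes> \<psi>) = 0 for every f in lcc (rcc); when neither space contains l1, the set of
  all x \<otimes> \<phi> with \<phi> in the dual ball is weakly precompact, and the same computation applies to wpL.
\<close>

subsection \<open>Norming functionals\<close>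

text \<open>All three parts rest on (x \<otimes> \<phi>)(y \<otimes> \<psi>) = \<phi>(y) (x
  \<otimes> \<psi>). If f(x \<otimes> \<psi>) is nonzero and the vectors or functionals of a weakly
  null sequence have norm at least 1, a matching partner in the unit ball keeps the scalar \<phi>(y)
  away from 0, so f stays away from 0 on these products. Hence f must vanish at every rank-one
  operator, and such functionals do not separate points. Part (a) yields only a disjunction because
  its test set is weakly precompact when X* has no copy of l1, while its weakly null sequence exists
  when X has none: the contradiction needs both failures at once. Rosenthal's theorem is stated for
  real functions on an arbitrary set of points, without topology. Taking the dual ball as that set,
  one combinatorial argument serves X and X* alike.\<close>

definition sublinear :: "('b::real_vector \<Rightarrow> real) \<Rightarrow> bool" where
  "sublinear p \<longleftrightarrow> (\<forall>x y. p (x + y) \<le> p x + p y) \<and> (\<forall>c>0. \<forall>x. p (c *\<^sub>R x) \<le> c * p x)"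

lemma sublinearI:
  assumes "\<And>x y. p (x + y) \<le> p x + p y" and "\<And>c x. c > 0 \<Longrightarrow> p (c *\<^sub>R x) \<le> c * p x"
  shows "sublinear p"
  using assms by (auto simp: sublinear_def)

lemma sublinear_add: "sublinear p \<Longrightarrow> p (x + y) \<le> p x + p y"
  by (auto simp: sublinear_def)

lemma sublinear_zero:
  assumes "sublinear p" shows "p 0 = 0"
proof -
  have "p (0 + 0) \<le> p 0 + p 0" and "p ((1/2) *\<^sub>R 0) \<le> (1/2) * p 0"
    using assms unfolding sublinear_def by (blast, meson half_gt_zero zero_less_one)
  then show ?thesis by simp
qed

text \<open>The missing inequality is the defining one for 1/c, applied at the point c x.\<close>

lemma sublinear_scale:
  assumes "sublinear p" "c \<ge> 0" shows "p (c *\<^sub>R x) = c * p x"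
proof (cases "c = 0")
  case True then show ?thesis using sublinear_zero[OF assms(1)] by simp
next
  case False
  then have c: "c > 0" using assms(2) by simp
  then have "p ((1/c) *\<^sub>R (c *\<^sub>R x)) \<le> (1/c) * p (c *\<^sub>R x)"
    using assms(1) unfolding sublinear_def by (meson zero_less_divide_1_iff)
  then have "c * p x \<le> p (c *\<^sub>R x)" using c by (simp add: field_simps)
  moreover have "p (c *\<^sub>R x) \<le> c * p x" using assms(1) c by (auto simp: sublinear_def)
  ultimately show ?thesis by simp
qed

lemma sublinear_lower:
  assumes "sublinear p" shows "- p (- x) \<le> p x"
  using sublinear_add[OF assms, of x "- x"] sublinear_zero[OF assms] by simp

text \<open>Zorn's lemma for the reversed pointwise order. The infimum over a chain is finite
  because every sublinear q \<le> p satisfies - p (- x) \<le> q x.\<close>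

lemma minimal_sublinear_exists:
  assumes p: "sublinear p"
  shows "\<exists>q. sublinear q \<and> q \<le> p \<and> (\<forall>q'. sublinear q' \<and> q' \<le> q \<longrightarrow> q' = q)"
proof -
  define A where "A = {q. sublinear q \<and> q \<le> p}"
  define R where "R = (\<lambda>f g :: 'a \<Rightarrow> real. g \<le> f)"
  have po: "partial_order_on A (relation_of R A)"
    unfolding R_def partial_order_on_def preorder_on_def relation_of_def refl_on_def trans_def antisym_def
    by auto
  have "\<exists>u\<in>A. \<forall>q\<in>C. R q u" if C: "C \<in> Chains (relation_of R A)" for C
  proof (cases "C = {}")
    case True then show ?thesis using p by (auto simp: A_def)
  next
    case False
    have CA: "C \<subseteq> A" and ch: "\<And>f g. f \<in> C \<Longrightarrow> g \<in> C \<Longrightarrow> f \<le> g \<or> g \<le> f"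
      using C by (auto simp: Chains_def relation_of_def R_def)
    define u where "u = (\<lambda>x. INF q\<in>C. q x)"
    have bdd: "bdd_below ((\<lambda>q. q x) ` C)" for x
    proof (rule bdd_belowI2)
      fix q assume "q \<in> C"
      then have "sublinear q" "q \<le> p" using CA by (auto simp: A_def)
      then show "- p (- x) \<le> q x" using sublinear_lower[of q x] by (smt (verit) le_funD)
    qed
    have ule: "u x \<le> q x" if "q \<in> C" for q x
      unfolding u_def by (rule cINF_lower[OF bdd that])
    have "sublinear u"
    proof (rule sublinearI)
      fix x y
      \<comment> \<open>Of two members of a chain one lies below the other; its subadditivity yields
        a bound in which the two infima can be taken independently.\<close>
      have 1: "u (x + y) \<le> q1 x + q2 y" if q: "q1 \<in> C" "q2 \<in> C" for q1 q2
      proof -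
        obtain m where m: "m \<in> C" "m \<le> q1" "m \<le> q2" using ch[OF q] q by blast
        then have "m (x + y) \<le> m x + m y" using CA by (auto simp: A_def intro: sublinear_add)
        then show ?thesis using ule[OF m(1), of "x + y"] m(2,3) by (smt (verit) le_funD)
      qed
      have "u (x + y) - q1 x \<le> u y" if "q1 \<in> C" for q1
        unfolding u_def[THEN fun_cong, of y] using False 1[OF that] by (intro cINF_greatest) (auto simp: algebra_simps)
      then have "u (x + y) - u y \<le> u x"
        unfolding u_def[THEN fun_cong, of x] using False by (intro cINF_greatest) (auto simp: algebra_simps)
      then show "u (x + y) \<le> u x + u y" by simp
    next
      fix c :: real and x assume c: "c > 0"
      have "u (c *\<^sub>R x) / c \<le> q x" if "q \<in> C" for q
        using ule[OF that, of "c *\<^sub>R x"] sublinear_scale[of q c x] that CA c by (auto simp: A_def field_simps)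
      then have "u (c *\<^sub>R x) / c \<le> u x"
        unfolding u_def[THEN fun_cong, of x] using False by (intro cINF_greatest) auto
      then show "u (c *\<^sub>R x) \<le> c * u x" using c by (simp add: field_simps)
    qed
    moreover have "u \<le> p"
    proof -
      obtain q where "q \<in> C" using False by blast
      then show ?thesis using ule[of q] CA by (auto simp: A_def le_fun_def intro: order_trans)
    qed
    ultimately show ?thesis using ule by (auto simp: A_def R_def le_fun_def)
  qed
  from predicate_Zorn[OF po this] obtain m where m: "m \<in> A" "\<And>q. q \<in> A \<Longrightarrow> q \<le> m \<Longrightarrow> q = m"
    unfolding R_def by blast
  then show ?thesis unfolding A_def by (intro exI[of _ m]) (auto intro: order_trans)
qed

text \<open>Applied to a minimal p, this gives p (- x) \<le> - p x, so minimal sublinear functionals are linear.\<close>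

lemma sublinear_shift:
  fixes p :: "'b::real_vector \<Rightarrow> real"
  assumes p: "sublinear p"
  obtains q where "sublinear q" "q \<le> p" "q (- x) \<le> - p x"
proof -
  \<comment> \<open>Any q as required satisfies q y \<le> q (y + t x) + t q (- x) \<le> p (y + t x)
    - t p x, so this infimum is the largest candidate. The value t = 0 gives q \<le> p, and t = 1 at
    - x gives the last property.\<close>
  define q where "q = (\<lambda>y. INF t\<in>{0..}. p (y + t *\<^sub>R x) - t * p x)"
  have bdd: "bdd_below ((\<lambda>t. p (y + t *\<^sub>R x) - t * p x) ` {0..})" for y
  proof (rule bdd_belowI2)
    fix t :: real assume "t \<in> {0..}"
    then show "- p (- y) \<le> p (y + t *\<^sub>R x) - t * p x"
      using sublinear_add[OF p, of "y + t *\<^sub>R x" "- y"] sublinear_scale[OF p, of t x] by simp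
  qed
  have qle: "q y \<le> p (y + t *\<^sub>R x) - t * p x" if "t \<ge> 0" for t y
    unfolding q_def using that by (intro cINF_lower[OF bdd]) auto
  have qge: "m \<le> q y" if "\<And>t. t \<ge> 0 \<Longrightarrow> m \<le> p (y + t *\<^sub>R x) - t * p x" for m y
    unfolding q_def using that by (intro cINF_greatest) auto
  show ?thesis
  proof
    show "sublinear q"
    proof (rule sublinearI)
      fix y z
      have 1: "q (y + z) - (p (y + s *\<^sub>R x) - s * p x) \<le> p (z + t *\<^sub>R x) - t * p x"
        if "s \<ge> 0" "t \<ge> 0" for s t
        using qle[of "s + t" "y + z"] sublinear_add[OF p, of "y + s *\<^sub>R x" "z + t *\<^sub>R x"] that
        by (simp add: algebra_simps)
      have "q (y + z) - (p (y + s *\<^sub>R x) - s * p x) \<le> q z" if "s \<ge> 0" for s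
        using 1[OF that] by (intro qge)
      then have "q (y + z) - q z \<le> q y" by (intro qge) (smt (verit))
      then show "q (y + z) \<le> q y + q z" by simp
    next
      fix c :: real and y assume c: "c > 0"
      have "q (c *\<^sub>R y) / c \<le> q y"
      proof (rule qge)
        fix t :: real assume t: "t \<ge> 0"
        have "q (c *\<^sub>R y) \<le> p (c *\<^sub>R y + (c * t) *\<^sub>R x) - (c * t) * p x"
          using c t by (intro qle) auto
        also have "c *\<^sub>R y + (c * t) *\<^sub>R x = c *\<^sub>R (y + t *\<^sub>R x)" by (simp add: scaleR_add_right)
        also have "p \<dots> = c * p (y + t *\<^sub>R x)" using c by (intro sublinear_scale[OF p]) simp
        finally show "q (c *\<^sub>R y) / c \<le> p (y + t *\<^sub>R x) - t * p x"
          using c by (simp add: field_simps)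
      qed
      then show "q (c *\<^sub>R y) \<le> c * q y" using c by (simp add: field_simps)
    qed
    show "q \<le> p" using qle[of 0] by (simp add: le_fun_def)
    show "q (- x) \<le> - p x" using qle[of 1 "- x"] sublinear_zero[OF p] by simp
  qed
qed

text \<open>Hahn-Banach without extending from a subspace: the norm is first lowered to a sublinear
  p with p (- x) \<le> - norm x; a minimal q below p is linear and inherits this bound, which forces
  q x = norm x.\<close>

lemma norming_functional:
  fixes x :: "'b::real_normed_vector"
  obtains \<phi> :: "'b \<Rightarrow>\<^sub>L real" where "norm \<phi> \<le> 1" "blinfun_apply \<phi> x = norm x"
proof -
  have "sublinear (norm :: 'b \<Rightarrow> real)" by (rule sublinearI) (auto intro: norm_triangle_ineq)
  then obtain p where p: "sublinear p" "p \<le> norm" "p (- x) \<le> - norm x"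
    by (rule sublinear_shift)
  obtain q where q: "sublinear q" "q \<le> p" and min: "\<And>q'. sublinear q' \<Longrightarrow> q' \<le> q \<Longrightarrow> q' = q"
    using minimal_sublinear_exists[OF p(1)] by blast
  have neg: "q (- y) = - q y" for y
  proof -
    obtain q' where "sublinear q'" "q' \<le> q" "q' (- y) \<le> - q y" by (rule sublinear_shift[OF q(1)])
    then have "q (- y) \<le> - q y" using min by metis
    then show ?thesis using sublinear_lower[OF q(1), of y] by simp
  qed
  have qn: "q y \<le> norm y" for y using q(2) p(2) by (auto simp: le_fun_def intro: order_trans)
  have add: "q (y + z) = q y + q z" for y z
    using sublinear_add[OF q(1), of y z] sublinear_add[OF q(1), of "- y" "- z"] neg[of "y + z"] neg[of y] neg[of z]
    by simp
  have sc: "q (c *\<^sub>R y) = c * q y" for c y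
  proof (cases "c \<ge> 0")
    case True then show ?thesis by (rule sublinear_scale[OF q(1)])
  next
    case False
    then have "q ((- c) *\<^sub>R y) = (- c) * q y" by (intro sublinear_scale[OF q(1)]) simp
    then show ?thesis using neg[of "c *\<^sub>R y"] by simp
  qed
  have ab: "\<bar>q y\<bar> \<le> norm y" for y using qn[of y] qn[of "- y"] neg[of y] by simp
  have bl: "bounded_linear q"
    by (rule bounded_linear_intro[where K = 1]) (use add sc ab in auto)
  show ?thesis
  proof
    show "norm (Blinfun q) \<le> 1"
      by (rule norm_blinfun_bound) (use ab in \<open>auto simp: bounded_linear_Blinfun_apply[OF bl]\<close>)
    have "q (- x) \<le> - norm x" using q(2) p(3) by (meson le_funD order_trans)
    then show "blinfun_apply (Blinfun q) x = norm x"
      using neg[of x] qn[of x] by (simp add: bounded_linear_Blinfun_apply[OF bl])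
  qed
qed

subsection \<open>Rosenthal's dichotomy\<close>

text \<open>Later \<open>n j\<close> lie in every earlier \<open>M i\<close>, so the range of
  \<open>n\<close> is almost contained in each \<open>M i\<close>. What a stage achieves on
  \<open>M i\<close> therefore holds along the whole diagonal, provided it passes to subsets and
  ignores finitely many indices.\<close>

lemma diagonal_choice:
  fixes R :: "nat \<Rightarrow> nat \<Rightarrow> nat set \<Rightarrow> bool"
  assumes M0: "infinite M0"
    and step: "\<And>i M. infinite M \<Longrightarrow> M \<subseteq> M0 \<Longrightarrow> \<exists>n\<in>M. \<exists>N\<subseteq>M. infinite N \<and> R i n N"
  obtains n M where "strict_mono n" "\<And>i. n i \<in> M0" "\<And>i. R i (n i) (M i)" "\<And>i j. i < j \<Longrightarrow> n j \<in> M i"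
proof -
  define P where "P = (\<lambda>i (n, N). n \<in> M0 \<and> N \<subseteq> M0 \<and> infinite N \<and> R i n N)"
  define Q where "Q = (\<lambda>(i::nat) (n::nat, N) (n', N'). n' \<in> N \<and> n < n' \<and> N' \<subseteq> (N :: nat set))"
  have "\<exists>z. \<forall>i. P i (z i) \<and> Q i (z i) (z (Suc i))"
  proof (rule dependent_nat_choice)
    show "\<exists>x. P 0 x" using step[OF M0 subset_refl, of 0] by (auto simp: P_def)
  next
    fix x i assume "P i x"
    then obtain n N where x: "x = (n, N)" "N \<subseteq> M0" "infinite N" by (auto simp: P_def split: prod.splits)
    \<comment> \<open>Indices up to \<open>n\<close> are discarded before the next stage, so that
      the chosen indices increase strictly.\<close>
    have "N \<inter> {n<..} = N - {..n}" by auto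
    then have "infinite (N \<inter> {n<..})" using x(3) by simp
    from step[OF this, of "Suc i"] obtain n' N' where
      "n' \<in> N \<inter> {n<..}" "N' \<subseteq> N \<inter> {n<..}" "infinite N'" "R (Suc i) n' N'"
      using x(2) by blast
    then show "\<exists>y. P (Suc i) y \<and> Q i x y"
      using x(2) by (intro exI[of _ "(n', N')"]) (auto simp: P_def Q_def x(1))
  qed
  then obtain z where z: "\<And>i. P i (z i)" "\<And>i. Q i (z i) (z (Suc i))" by blast
  have anti: "snd (z j) \<subseteq> snd (z i)" if "i \<le> j" for i j
    using that by (rule lift_Suc_antimono_le[of "\<lambda>i. snd (z i)", rotated])
      (use z(2) in \<open>auto simp: Q_def case_prod_unfold\<close>)
  show ?thesis
  proof
    show "strict_mono (\<lambda>i. fst (z i))"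
      using z(2) by (simp add: strict_mono_Suc_iff Q_def case_prod_unfold)
    show "fst (z i) \<in> M0" "R i (fst (z i)) (snd (z i))" for i
      using z(1)[of i] by (auto simp: P_def split: prod.splits)
    show "fst (z j) \<in> snd (z i)" if "i < j" for i j
    proof -
      define k where "k = j - 1"
      have k: "j = Suc k" "i \<le> k" using that by (auto simp: k_def)
      have "fst (z j) \<in> snd (z k)" using z(2)[of k] k by (auto simp: Q_def split: prod.splits)
      then show ?thesis using anti[OF k(2)] by blast
    qed
  qed
qed

text \<open>For A n = {s. f n s < p} and B n = {s. f n s > q} with p < q, such a point s has lower
  limit at most p and upper limit at least q along \<open>N\<close>.\<close>

definition oscillates :: "(nat \<Rightarrow> 's set) \<Rightarrow> (nat \<Rightarrow> 's set) \<Rightarrow> nat set \<Rightarrow> 's \<Rightarrow> bool" where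
  "oscillates A B N s \<longleftrightarrow> infinite {n\<in>N. s \<in> A n} \<and> infinite {n\<in>N. s \<in> B n}"

text \<open>Negated, some infinite subset of \<open>M\<close> carries no oscillating point of
  \<open>X\<close>. Quantifying over all infinite subsets makes the property survive every later
  thinning of \<open>M\<close>.\<close>

definition hereditarily_oscillating ::
    "(nat \<Rightarrow> 's set) \<Rightarrow> (nat \<Rightarrow> 's set) \<Rightarrow> nat set \<Rightarrow> 's set \<Rightarrow> bool" where
  "hereditarily_oscillating A B M X \<longleftrightarrow> (\<forall>N\<subseteq>M. infinite N \<longrightarrow> (\<exists>s\<in>X. oscillates A B N s))"

lemma hereditarily_oscillating_mono:
  "hereditarily_oscillating A B M X \<Longrightarrow> N \<subseteq> M \<Longrightarrow> hereditarily_oscillating A B N X"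
  unfolding hereditarily_oscillating_def by (meson subset_trans)

text \<open>Oscillation does not see finitely many indices; this lets a diagonal set be compared
  with each of its stages.\<close>

lemma oscillates_almost_mono:
  assumes "oscillates A B N s" "finite (N - M)" shows "oscillates A B M s"
proof -
  have "infinite {n\<in>M. s \<in> C n}" if "infinite {n\<in>N. s \<in> C n}" for C
  proof
    assume "finite {n\<in>M. s \<in> C n}"
    then have "finite ({n\<in>M. s \<in> C n} \<union> (N - M))" using assms(2) by simp
    moreover have "{n\<in>N. s \<in> C n} \<subseteq> {n\<in>M. s \<in> C n} \<union> (N - M)" by auto
    ultimately show False using that by (meson finite_subset)
  qed
  then show ?thesis using assms(1) by (auto simp: oscillates_def)
qed

lemma finite_diagonal_tail:
  assumes "\<And>i j. i < j \<Longrightarrow> n j \<in> M i" shows "finite (n ` I - M (i::nat))"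
proof (rule finite_subset)
  show "n ` I - M i \<subseteq> n ` {..i}" using assms by (auto intro: leI)
qed simp

text \<open>Otherwise every n spoils some X with A n or B n on a smaller index set; along a diagonal set on which
  the same X and the same side are always spoiled, no point of X can oscillate.\<close>

lemma hereditarily_oscillating_split:
  assumes fin: "finite \<X>" and M: "infinite M"
    and osc: "\<And>X. X \<in> \<X> \<Longrightarrow> hereditarily_oscillating A B M X"
  obtains n N where "n \<in> M" "N \<subseteq> M" "infinite N"
    "\<And>X. X \<in> \<X> \<Longrightarrow> hereditarily_oscillating A B N (X \<inter> A n) \<and> hereditarily_oscillating A B N (X \<inter> B n)"
proof (rule ccontr)
  assume "\<not> thesis"
  note neg = this and wit = that
  define D where "D = (\<lambda>t n. if t then A n else B n)"
  \<comment> \<open>\<open>z\<close> records what is spoiled: a member of the family and a side,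
    \<open>True\<close> for A and \<open>False\<close> for B. Every stage makes the same
    demand.\<close>
  define R where "R = (\<lambda>(i::nat) n N. \<exists>z\<in>\<X> \<times> (UNIV::bool set). \<forall>s\<in>fst z \<inter> D (snd z) n. \<not> oscillates A B N s)"
  have step: "\<exists>n\<in>N. \<exists>N'\<subseteq>N. infinite N' \<and> R i n N'" if N: "infinite N" "N \<subseteq> M" for i N
  proof -
    obtain n where n: "n \<in> N" using N(1) by (metis finite.emptyI ex_in_conv)
    have "\<exists>X\<in>\<X>. \<exists>t. \<not> hereditarily_oscillating A B N (X \<inter> D t n)"
    proof (rule ccontr)
      assume "\<not> ?thesis"
      then have "hereditarily_oscillating A B N (X \<inter> D True n)" "hereditarily_oscillating A B N (X \<inter> D False n)"
        if "X \<in> \<X>" for X using that by blast+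
      then have thesis using n N by (intro wit[of n N]) (auto simp: D_def)
      with neg show False ..
    qed
    then obtain X t N' where "X \<in> \<X>" "N' \<subseteq> N" "infinite N'" "\<forall>s\<in>X \<inter> D t n. \<not> oscillates A B N' s"
      unfolding hereditarily_oscillating_def by blast
    then have "R i n N'" unfolding R_def by (intro bexI[of _ "(X, t)"]) simp_all
    with n show ?thesis using \<open>N' \<subseteq> N\<close> \<open>infinite N'\<close> by blast
  qed
  obtain n L where n: "strict_mono n" "\<And>i. n i \<in> M" "\<And>i. R i (n i) (L i)" "\<And>i j. i < j \<Longrightarrow> n j \<in> L i"
    using diagonal_choice[OF M, of R] step by blast
  obtain z where z: "\<And>i. z i \<in> \<X> \<times> (UNIV::bool set)"
     "\<And>i s. s \<in> fst (z i) \<inter> D (snd (z i)) (n i) \<Longrightarrow> \<not> oscillates A B (L i) s"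
  proof -
    have "\<forall>i. \<exists>z. z \<in> \<X> \<times> (UNIV::bool set)
        \<and> (\<forall>s\<in>fst z \<inter> D (snd z) (n i). \<not> oscillates A B (L i) s)"
      using n(3) unfolding R_def by blast
    then show ?thesis using that by (elim choice[THEN exE]) blast
  qed
  \<comment> \<open>With finitely many sets and two sides, one pair recurs at infinitely many
    stages; only these are kept.\<close>
  have "finite (range z)" 
    using fin by (intro finite_subset[OF image_subsetI[OF z(1)]]) simp
  then obtain i0 where i0: "infinite {i. z i = z i0}"
    using pigeonhole_infinite[of UNIV z] by auto
  obtain X t where Xt: "z i0 = (X, t)" by fastforce
  define I where "I = {i. z i = (X, t)}"
  have I: "infinite I" using i0 by (simp add: I_def Xt)
  have inj: "inj n" using n(1) by (rule strict_mono_imp_inj_on)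
  have "infinite (n ` I)" using I finite_imageD[OF _ inj_on_subset[OF inj subset_UNIV]] by blast
  moreover have "n ` I \<subseteq> M" using n(2) by auto
  moreover have "X \<in> \<X>" using z(1)[of i0] Xt by simp
  ultimately obtain s where s: "s \<in> X" "oscillates A B (n ` I) s"
    using osc unfolding hereditarily_oscillating_def by blast
  \<comment> \<open>Oscillation gives infinitely many indices on either side; a single one on the
    spoiled side is enough for a contradiction.\<close>
  then have "infinite {m \<in> n ` I. s \<in> D t m}" by (cases t) (simp_all add: oscillates_def D_def)
  then have "{m \<in> n ` I. s \<in> D t m} \<noteq> {}" by (metis finite.emptyI)
  then obtain i where "i \<in> I" "s \<in> D t (n i)" by blast
  then have "\<not> oscillates A B (L i) s" using z(2)[of s i] s(1) by (auto simp: I_def)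
  moreover have "oscillates A B (L i) s"
    by (rule oscillates_almost_mono[OF s(2)]) (rule finite_diagonal_tail[OF n(4)])
  ultimately show False by contradiction
qed

text \<open>A point of the cell realises the pattern \<open>P\<close> on \<open>F\<close>. The sets
  \<open>A n\<close> and \<open>B n\<close> need not be complementary; nonempty cells for all
  patterns mean that the pairs of \<open>A n\<close> and \<open>B n\<close> with n in
  \<open>F\<close> are independent on \<open>S\<close>.\<close>

definition cell :: "(nat \<Rightarrow> 's set) \<Rightarrow> (nat \<Rightarrow> 's set) \<Rightarrow> 's set \<Rightarrow> nat set \<Rightarrow> nat set \<Rightarrow> 's set" where
  "cell A B S F P = {s\<in>S. \<forall>n\<in>F. s \<in> (if n \<in> P then A n else B n)}"

text \<open>The invariant \<open>good\<close> asks more than nonempty cells: all of them stay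
  hereditarily oscillating on one common infinite set, so that the splitting lemma can refine the
  finitely many cells at once. Nonemptiness follows at the end, since hereditary oscillation on an
  infinite set already provides a point.\<close>

lemma independent_subsequence:
  assumes M: "infinite M" and S: "hereditarily_oscillating A B M S"
  obtains n :: "nat \<Rightarrow> nat" where "strict_mono n" "\<And>k P. cell A B S (n ` {..k}) P \<noteq> {}"
proof -
  define good where
    "good = (\<lambda>F M. finite F \<and> infinite M \<and> (\<forall>P. hereditarily_oscillating A B M (cell A B S F P)))"
  have step: "\<exists>m N. m > b \<and> good (insert m F) N" if F: "good F L" for b F L
  proof -
    define L' where "L' = L \<inter> {b<..}"
    have "L' = L - {..b}" by (auto simp: L'_def)
    then have "infinite L'" using F by (simp add: good_def)
    moreover have "finite (cell A B S F ` Pow F)" using F by (simp add: good_def)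
    moreover have "hereditarily_oscillating A B L' X" if "X \<in> cell A B S F ` Pow F" for X
      using that F unfolding good_def L'_def by (auto intro: hereditarily_oscillating_mono)
    ultimately obtain m N where mN: "m \<in> L'" "N \<subseteq> L'" "infinite N" and
      N: "\<And>X. X \<in> cell A B S F ` Pow F \<Longrightarrow>
         hereditarily_oscillating A B N (X \<inter> A m) \<and> hereditarily_oscillating A B N (X \<inter> B m)"
      using hereditarily_oscillating_split[of "cell A B S F ` Pow F" L' A B] by blast
    have "hereditarily_oscillating A B N (cell A B S (insert m F) P)" for P
    proof -
      have *: "cell A B S F P = cell A B S F (P \<inter> F)" by (auto simp: cell_def)
      have "cell A B S (insert m F) P = cell A B S F P \<inter> (if m \<in> P then A m else B m)"
        by (auto simp: cell_def)
      moreover have "cell A B S F P \<in> cell A B S F ` Pow F" by (subst *) blast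
      ultimately show ?thesis using N by auto
    qed
    then show ?thesis using mN F by (intro exI[of _ m] exI[of _ N]) (auto simp: good_def L'_def)
  qed
  \<comment> \<open>Fixing \<open>F\<close> at stage 0 makes the set at stage i consist of exactly
    the first i + 1 chosen indices.\<close>
  define P where "P = (\<lambda>i (n::nat, F, L). good F L \<and> (i = (0::nat) \<longrightarrow> F = {n}))"
  define Q where "Q = (\<lambda>(i::nat) (n::nat, F::nat set, L::nat set) (n', F', L'::nat set). n < n' \<and> F' = insert n' F)"
  have "\<exists>z. \<forall>i. P i (z i) \<and> Q i (z i) (z (Suc i))"
  proof (rule dependent_nat_choice)
    have "good {} M" using M S by (simp add: good_def cell_def)
    then obtain m N where "good {m} N" using step by blast
    then show "\<exists>x. P 0 x" by (intro exI[of _ "(m, {m}, N)"]) (auto simp: P_def)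
  next
    fix x i assume "P i x"
    then obtain n F L where x: "x = (n, F, L)" "good F L" by (auto simp: P_def split: prod.splits)
    obtain m N where "m > n" "good (insert m F) N" using step[OF x(2)] by blast
    then show "\<exists>y. P (Suc i) y \<and> Q i x y"
      by (intro exI[of _ "(m, insert m F, N)"]) (auto simp: P_def Q_def x(1))
  qed
  then obtain z where z: "\<And>i. P i (z i)" "\<And>i. Q i (z i) (z (Suc i))" by blast
  define n where "n = (\<lambda>i. fst (z i))"
  have F: "fst (snd (z i)) = n ` {..i}" for i
  proof (induction i)
    case 0 then show ?case using z(1)[of 0] by (auto simp: P_def n_def split: prod.splits)
  next
    case (Suc i)
    then show ?case using z(2)[of i]
      by (auto simp: Q_def n_def atMost_Suc split: prod.splits)
  qed
  show ?thesis
  proof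
    show "strict_mono n"
      using z(2) by (simp add: strict_mono_Suc_iff n_def Q_def case_prod_unfold)
    show "cell A B S (n ` {..k}) P' \<noteq> {}" for k P'
    proof -
      have "good (n ` {..k}) (snd (snd (z k)))"
        using z(1)[of k] F[of k] by (auto simp: P_def split: prod.splits)
      then show ?thesis unfolding good_def hereditarily_oscillating_def by blast
    qed
  qed
qed

text \<open>The limit \<open>l\<close> of a subsequence is approached infinitely often, yet on one
  side of it infinitely many terms stay at distance at least \<open>e\<close>; the two thresholds
  fit in between. They are rational so that only countably many pairs have to be treated.\<close>

lemma bounded_not_convergent_oscillates:
  fixes x :: "nat \<Rightarrow> real"
  assumes b: "bounded (range x)" and nc: "\<not> convergent x"
  obtains p q :: rat where "p < q" "infinite {i. x i < of_rat p}" "infinite {i. x i > of_rat q}"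
proof -
  obtain l r where r: "strict_mono (r :: nat \<Rightarrow> nat)" "(x \<circ> r) \<longlonglongrightarrow> l"
    using bounded_imp_convergent_subsequence[OF b] by blast
  have "\<not> x \<longlonglongrightarrow> l" using nc by (auto simp: convergent_def)
  then obtain e where e: "e > 0" "\<exists>\<^sub>F i in sequentially. \<not> dist (x i) l < e"
    by (auto simp: tendsto_iff not_eventually)
  have near: "infinite {i. \<bar>x i - l\<bar> < d}" if "d > 0" for d
  proof -
    have "eventually (\<lambda>k. dist ((x \<circ> r) k) l < d) sequentially" using tendstoD[OF r(2) that] .
    then obtain N where N: "\<And>k. k \<ge> N \<Longrightarrow> \<bar>x (r k) - l\<bar> < d"
      by (auto simp: eventually_sequentially dist_real_def)
    have "infinite (r ` {N..})"
      using finite_imageD[OF _ inj_on_subset[OF strict_mono_imp_inj_on[OF r(1)] subset_UNIV]] infinite_Ici[of N]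
      by blast
    then show ?thesis by (rule infinite_super[rotated]) (use N in auto)
  qed
  have "infinite {i. \<not> dist (x i) l < e}"
    using e(2) by (simp add: frequently_cofinite[symmetric] cofinite_eq_sequentially)
  moreover have "{i. \<not> dist (x i) l < e} \<subseteq> {i. x i \<ge> l + e} \<union> {i. x i \<le> l - e}"
    by (auto simp: dist_real_def)
  ultimately have "infinite {i. x i \<ge> l + e} \<or> infinite {i. x i \<le> l - e}"
    by (meson finite_UnI finite_subset)
  then show ?thesis
  proof
    assume i: "infinite {i. x i \<ge> l + e}"
    obtain p where p: "l < of_rat p" "of_rat p < l + e" using of_rat_dense[of l "l + e"] e(1) by auto
    obtain q where q: "of_rat p < (of_rat q :: real)" "of_rat q < l + e" using of_rat_dense[OF p(2)] by auto
    show ?thesis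
    proof
      show "p < q" using q(1) by (simp add: of_rat_less)
      show "infinite {i. x i < of_rat p}"
        by (rule infinite_super[OF _ near[of "of_rat p - l"]]) (use p in auto)
      show "infinite {i. x i > of_rat q}" by (rule infinite_super[OF _ i]) (use q in auto)
    qed
  next
    assume i: "infinite {i. x i \<le> l - e}"
    obtain p where p: "l - e < of_rat p" "of_rat p < l" using of_rat_dense[of "l - e" l] e(1) by auto
    obtain q where q: "of_rat p < (of_rat q :: real)" "of_rat q < l" using of_rat_dense[OF p(2)] by auto
    show ?thesis
    proof
      show "p < q" using q(1) by (simp add: of_rat_less)
      show "infinite {i. x i < of_rat p}" by (rule infinite_super[OF _ i]) (use p in auto)
      show "infinite {i. x i > of_rat q}"
        by (rule infinite_super[OF _ near[of "l - of_rat q"]]) (use q in auto)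
    qed
  qed
qed

text \<open>If some gap p < q oscillates hereditarily, independence yields the l1 estimate.
  Otherwise each rational gap can be removed by thinning the index set, and all of them by
  diagonalisation; a bounded sequence without such a gap converges.\<close>

lemma rosenthal_dichotomy:
  fixes f :: "nat \<Rightarrow> 's \<Rightarrow> real"
  assumes bdd: "\<And>s. s \<in> S \<Longrightarrow> bounded (range (\<lambda>n. f n s))"
  obtains (convergent) r :: "nat \<Rightarrow> nat" where "strict_mono r" "\<And>s. s \<in> S \<Longrightarrow> convergent (\<lambda>n. f (r n) s)"
    | (l1) r :: "nat \<Rightarrow> nat" and \<delta> :: real where "strict_mono r" "\<delta> > 0"
      "\<And>c k. \<exists>s\<in>S. \<delta> * (\<Sum>i<k. \<bar>c i\<bar>) \<le> \<bar>\<Sum>i<k. c i * f (r i) s\<bar>"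
proof -
  define A where "A = (\<lambda>(p::rat) n. {s. f n s < of_rat p})"
  define B where "B = (\<lambda>(q::rat) n. {s. f n s > of_rat q})"
  show ?thesis
  proof (cases "\<exists>p q M. p < q \<and> infinite M \<and> hereditarily_oscillating (A p) (B q) M S")
    case True
    then obtain p q M where pq: "p < q" and M: "infinite M" "hereditarily_oscillating (A p) (B q) M S"
      by blast
    obtain n :: "nat \<Rightarrow> nat" where n: "strict_mono n" and cell: "\<And>k P. cell (A p) (B q) S (n ` {..k}) P \<noteq> {}"
      using independent_subsequence[OF M] by blast
    define \<delta> where "\<delta> = (of_rat q - of_rat p) / (2 :: real)"
    have \<delta>: "\<delta> > 0" using pq by (simp add: \<delta>_def of_rat_less)
    show ?thesis
    proof (rule l1[OF n \<delta>])
      fix c :: "nat \<Rightarrow> real" and k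
      have inj: "inj n" using n by (rule strict_mono_imp_inj_on)
      \<comment> \<open>The points \<open>s\<close> and \<open>t\<close> follow the signs of
        \<open>c\<close> in opposite ways. Subtracting the two sums cancels the unknown position of
        p and q relative to 0, and each term contributes at least (q - p) \<bar>c i\<bar>. One of
        the two sums then has modulus at least half the total, whence the 2 in \<delta>.\<close>
      obtain s where s: "s \<in> cell (A p) (B q) S (n ` {..k}) (n ` {i. c i \<le> 0})" using cell by blast
      obtain t where t: "t \<in> cell (A p) (B q) S (n ` {..k}) (n ` {i. c i > 0})" using cell by blast
      have cs: "s \<in> (if c i \<le> 0 then A p (n i) else B q (n i))"
        and ct: "t \<in> (if c i > 0 then A p (n i) else B q (n i))" if "i < k" for i
        using s t that inj by (simp_all add: cell_def inj_image_mem_iff)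
      have ST: "s \<in> S" "t \<in> S" using s t by (auto simp: cell_def)
      have sgn: "2 * \<delta> * \<bar>c i\<bar> \<le> c i * f (n i) s - c i * f (n i) t" if "i < k" for i
      proof (cases "c i > 0")
        case True
        have "s \<in> B q (n i)" using cs[OF that] True by simp
        moreover have "t \<in> A p (n i)" using ct[OF that] True by simp
        ultimately have "2 * \<delta> \<le> f (n i) s - f (n i) t" by (auto simp: A_def B_def \<delta>_def)
        then have "c i * (2 * \<delta>) \<le> c i * (f (n i) s - f (n i) t)" using True by (intro mult_left_mono) auto
        then show ?thesis using True by (simp add: algebra_simps)
      next
        case False
        have "s \<in> A p (n i)" using cs[OF that] False by simp
        moreover have "t \<in> B q (n i)" using ct[OF that] False by simp
        ultimately have "2 * \<delta> \<le> f (n i) t - f (n i) s" by (auto simp: A_def B_def \<delta>_def)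
        then have "(- c i) * (2 * \<delta>) \<le> (- c i) * (f (n i) t - f (n i) s)" using False by (intro mult_left_mono) auto
        then show ?thesis using False by (simp add: algebra_simps)
      qed
      have "2 * \<delta> * (\<Sum>i<k. \<bar>c i\<bar>) \<le> (\<Sum>i<k. c i * f (n i) s) - (\<Sum>i<k. c i * f (n i) t)"
        using sgn unfolding sum_distrib_left sum_subtractf[symmetric] by (intro sum_mono) auto
      then have "\<delta> * (\<Sum>i<k. \<bar>c i\<bar>) \<le> \<bar>\<Sum>i<k. c i * f (n i) s\<bar> \<or> \<delta> * (\<Sum>i<k. \<bar>c i\<bar>) \<le> \<bar>\<Sum>i<k. c i * f (n i) t\<bar>"
        by linarith
      then show "\<exists>s\<in>S. \<delta> * (\<Sum>i<k. \<bar>c i\<bar>) \<le> \<bar>\<Sum>i<k. c i * f (n i) s\<bar>" using ST by blast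
    qed
  next
    case False
    \<comment> \<open>Stage i treats the i-th pair of rationals; a pair with p \<ge> q imposes
      nothing.\<close>
    define R where "R = (\<lambda>i (n::nat) N. case from_nat i of (p, q) \<Rightarrow>
        p < q \<longrightarrow> (\<forall>s\<in>S. \<not> oscillates (A p) (B q) N s))"
    have step: "\<exists>n\<in>M. \<exists>N\<subseteq>M. infinite N \<and> R i n N" if M: "infinite M" "M \<subseteq> UNIV" for i M
    proof -
      obtain n where n: "n \<in> M" using M(1) by (metis finite.emptyI ex_in_conv)
      obtain p q :: rat where pq: "from_nat i = (p, q)" by fastforce
      have "\<exists>N\<subseteq>M. infinite N \<and> (p < q \<longrightarrow> (\<forall>s\<in>S. \<not> oscillates (A p) (B q) N s))"
      proof (cases "p < q")
        case True
        then have "\<not> hereditarily_oscillating (A p) (B q) M S" using False M(1) by blast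
        then show ?thesis unfolding hereditarily_oscillating_def by blast
      qed (use M(1) in blast)
      moreover have "R i n N \<longleftrightarrow> (p < q \<longrightarrow> (\<forall>s\<in>S. \<not> oscillates (A p) (B q) N s))" for N
        by (simp add: R_def pq)
      ultimately show ?thesis using n by (intro bexI[of _ n]) simp_all
    qed
    obtain n L where n: "strict_mono n" "\<And>i. R i (n i) (L i)" "\<And>i j. i < j \<Longrightarrow> n j \<in> L i"
      by (rule diagonal_choice[OF infinite_UNIV_nat, of R, OF step]) (assumption | rule that)+
    show ?thesis
    proof (rule convergent[OF n(1)], rule ccontr)
      fix s assume s: "s \<in> S" and nc: "\<not> convergent (\<lambda>i. f (n i) s)"
      have "bounded (range (\<lambda>i. f (n i) s))" by (rule bounded_subset[OF bdd[OF s]]) auto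
      then obtain p q :: rat where pq: "p < q"
        and inf: "infinite {i. f (n i) s < of_rat p}" "infinite {i. f (n i) s > of_rat q}"
        by (rule bounded_not_convergent_oscillates[OF _ nc])
      have inj: "inj n" using n(1) by (rule strict_mono_imp_inj_on)
      have img: "infinite {m\<in>range n. Q m}" if "infinite {i. Q (n i)}" for Q
      proof -
        have "{m\<in>range n. Q m} = n ` {i. Q (n i)}" by auto
        moreover have "infinite (n ` {i. Q (n i)})"
          using that finite_imageD[OF _ inj_on_subset[OF inj subset_UNIV]] by blast
        ultimately show ?thesis by simp
      qed
      have "oscillates (A p) (B q) (range n) s"
        using img[OF inf(1)] img[OF inf(2)] by (simp add: oscillates_def A_def B_def)
      then have "oscillates (A p) (B q) (L (to_nat (p, q))) s"
        by (rule oscillates_almost_mono) (rule finite_diagonal_tail[OF n(3)])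
      then show False using n(2)[of "to_nat (p, q)"] pq s by (simp add: R_def)
    qed
  qed
qed

subsection \<open>Sequences equivalent to the unit vector basis of l1\<close>

text \<open>The matching upper estimate by the l1 norm of the coefficients follows from
  boundedness.\<close>

definition l1_sequence :: "(nat \<Rightarrow> 'b::real_normed_vector) \<Rightarrow> bool" where
  "l1_sequence y \<longleftrightarrow> bounded (range y) \<and>
     (\<exists>\<delta>>0. \<forall>c k. \<delta> * (\<Sum>i<k. \<bar>c i\<bar>) \<le> norm (\<Sum>i<k. c i *\<^sub>R y i))"

text \<open>The points are the functionals of the dual ball: an l1 estimate at one of them bounds
  the norm of the combination from below, and convergence extends from the ball to all functionals
  by scaling.\<close>

lemma rosenthal_l1:
  fixes y :: "nat \<Rightarrow> 'b::real_normed_vector"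
  assumes bdd: "bounded (range y)" and no_l1: "\<And>y :: nat \<Rightarrow> 'b. \<not> l1_sequence y"
  obtains r :: "nat \<Rightarrow> nat" where "strict_mono r"
    "\<And>g :: 'b \<Rightarrow>\<^sub>L real. convergent (\<lambda>n. g (y (r n)))"
proof -
  have "bounded (range (\<lambda>n. blinfun_apply g (y n)))" for g :: "'b \<Rightarrow>\<^sub>L real"
    using bounded_linear_image[OF bdd blinfun.bounded_linear_right[of g]] by (simp add: image_image)
  then show ?thesis
  proof (cases rule: rosenthal_dichotomy[where f = "\<lambda>n g. blinfun_apply g (y n)" and S = "{g. norm g \<le> 1}"])
    case (convergent r)
    have "convergent (\<lambda>n. g (y (r n)))" for g :: "'b \<Rightarrow>\<^sub>L real"
    proof (cases "g = 0")
      case True then show ?thesis by (simp add: convergent_const)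
    next
      case False
      then have "convergent (\<lambda>n. blinfun_apply (g /\<^sub>R norm g) (y (r n)))" by (intro convergent(2)) simp
      then have "convergent (\<lambda>n. norm g * blinfun_apply (g /\<^sub>R norm g) (y (r n)))"
        by (intro convergent_mult convergent_const)
      then show ?thesis using False by (simp add: blinfun.scaleR_left mult.assoc[symmetric])
    qed
    then show ?thesis by (rule that[OF convergent(1)])
  next
    case (l1 r \<delta>)
    have "\<delta> * (\<Sum>i<k. \<bar>c i\<bar>) \<le> norm (\<Sum>i<k. c i *\<^sub>R y (r i))" for c k
    proof -
      obtain g :: "'b \<Rightarrow>\<^sub>L real" where g: "norm g \<le> 1"
        "\<delta> * (\<Sum>i<k. \<bar>c i\<bar>) \<le> \<bar>\<Sum>i<k. c i * g (y (r i))\<bar>" using l1(3)[of c k] by blast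
      note g(2)
      also have "(\<Sum>i<k. c i * g (y (r i))) = g (\<Sum>i<k. c i *\<^sub>R y (r i))"
        by (simp add: blinfun.sum_right blinfun.scaleR_right)
      also have "\<bar>\<dots>\<bar> \<le> norm g * norm (\<Sum>i<k. c i *\<^sub>R y (r i))"
        using norm_blinfun[of g] by (metis real_norm_def)
      also have "\<dots> \<le> norm (\<Sum>i<k. c i *\<^sub>R y (r i))" using g(1) by (simp add: mult_left_le_one_le)
      finally show ?thesis .
    qed
    moreover have "bounded (range (\<lambda>i. y (r i)))" by (rule bounded_subset[OF bdd]) auto
    ultimately have "l1_sequence (\<lambda>i. y (r i))" using l1(2)
      unfolding l1_sequence_def by (intro conjI exI[of _ \<delta>]) simp_all
    with no_l1 show ?thesis by blast
  qed
qed

lemma l1_sequence_embedding: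
  fixes y :: "nat \<Rightarrow> 'b::banach"
  assumes "l1_sequence y"
  obtains J and \<delta> K :: real where "\<delta> > 0"
    "\<And>x x'. x \<in> l1 \<Longrightarrow> x' \<in> l1 \<Longrightarrow> J (\<lambda>n. x n + x' n) = J x + (J x' :: 'b)"
    "\<And>x r. x \<in> l1 \<Longrightarrow> J (\<lambda>n. r * x n) = r *\<^sub>R J x"
    "\<And>x. x \<in> l1 \<Longrightarrow> \<delta> * l1norm x \<le> norm (J x)" "\<And>x. x \<in> l1 \<Longrightarrow> norm (J x) \<le> K * l1norm x"
proof -
  obtain K where K: "\<And>n. norm (y n) \<le> K" using assms by (auto simp: l1_sequence_def bounded_iff)
  obtain \<delta> where \<delta>: "\<delta> > 0" "\<And>c k. \<delta> * (\<Sum>i<k. \<bar>c i\<bar>) \<le> norm (\<Sum>i<k. c i *\<^sub>R y i)"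
    using assms by (auto simp: l1_sequence_def)
  define J where "J = (\<lambda>x. \<Sum>n. x n *\<^sub>R y n)"
  have nb: "norm (norm (x n *\<^sub>R y n)) \<le> K * \<bar>x n\<bar>" for x :: "nat \<Rightarrow> real" and n
    using mult_right_mono[OF K[of n], of "\<bar>x n\<bar>"] by (simp add: mult.commute)
  have sK: "summable (\<lambda>n. K * \<bar>x n\<bar>)" if "x \<in> l1" for x using that by (simp add: l1_def summable_mult)
  have ns: "summable (\<lambda>n. norm (x n *\<^sub>R y n))" if "x \<in> l1" for x
    by (rule summable_comparison_test'[OF sK[OF that]]) (rule nb)
  have s: "summable (\<lambda>n. x n *\<^sub>R y n)" if "x \<in> l1" for x by (rule summable_norm_cancel[OF ns[OF that]])
  show ?thesis
  proof (rule that[OF \<delta>(1), of J K])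
    fix x x' :: "nat \<Rightarrow> real" assume "x \<in> l1" "x' \<in> l1"
    then show "J (\<lambda>n. x n + x' n) = J x + J x'" by (simp add: J_def scaleR_add_left suminf_add s)
  next
    fix x :: "nat \<Rightarrow> real" and r :: real assume "x \<in> l1"
    then show "J (\<lambda>n. r * x n) = r *\<^sub>R J x"
      by (simp add: J_def scaleR_scaleR[symmetric] suminf_scaleR_right s del: scaleR_scaleR)
  next
    fix x :: "nat \<Rightarrow> real" assume x: "x \<in> l1"
    have "(\<lambda>k. \<delta> * (\<Sum>i<k. \<bar>x i\<bar>)) \<longlonglongrightarrow> \<delta> * l1norm x"
      using x by (auto simp: l1_def l1norm_def intro!: tendsto_mult_left summable_LIMSEQ)
    moreover have "(\<lambda>k. norm (\<Sum>i<k. x i *\<^sub>R y i)) \<longlonglongrightarrow> norm (J x)"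
      unfolding J_def by (intro tendsto_norm summable_LIMSEQ s x)
    ultimately show "\<delta> * l1norm x \<le> norm (J x)" by (rule LIMSEQ_le) (use \<delta>(2) in blast)
    have "norm (J x) \<le> (\<Sum>n. norm (x n *\<^sub>R y n))" unfolding J_def by (rule summable_norm[OF ns[OF x]])
    also have "\<dots> \<le> (\<Sum>n. K * \<bar>x n\<bar>)" using nb[of x] by (intro suminf_le ns sK x) simp
    also have "\<dots> = K * l1norm x" using x by (simp add: l1norm_def l1_def suminf_mult)
    finally show "norm (J x) \<le> K * l1norm x" .
  qed
qed

text \<open>Both \<open>\<Phi>\<close> and \<open>T\<close> after \<open>\<Phi>\<close> are positive
  multiples of isometries, so \<open>T\<close> scales norms by m' / m on the range of
  \<open>\<Phi>\<close>, and in particular on the copy of l1 sent there.\<close>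

lemma fixes_l1I:
  fixes y :: "nat \<Rightarrow> 'b::banach" and \<Phi> :: "'b \<Rightarrow> ('a::real_normed_vector \<Rightarrow>\<^sub>L 'a)"
  assumes y: "l1_sequence y" and lin: "linear \<Phi>" and Kop: "\<And>u. \<Phi> u \<in> Kop"
    and m: "m > 0" "\<And>u. norm (\<Phi> u) = m * norm u"
    and m': "m' > 0" "\<And>u. norm (T (\<Phi> u)) = m' * norm u"
  shows "fixes_l1 T"
proof -
  obtain J \<delta> K where J: "\<delta> > 0"
    "\<And>x x'. x \<in> l1 \<Longrightarrow> x' \<in> l1 \<Longrightarrow> J (\<lambda>n. x n + x' n) = J x + (J x' :: 'b)"
    "\<And>x r. x \<in> l1 \<Longrightarrow> J (\<lambda>n. r * x n) = r *\<^sub>R J x"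
    "\<And>x. x \<in> l1 \<Longrightarrow> \<delta> * l1norm x \<le> norm (J x)" "\<And>x. x \<in> l1 \<Longrightarrow> norm (J x) \<le> K * l1norm x"
    by (rule l1_sequence_embedding[OF y]) (assumption | rule that)+
  show ?thesis
    unfolding fixes_l1_def
  proof (rule exI[of _ "\<lambda>x. \<Phi> (J x)"], rule exI[of _ "m * \<delta>"], rule exI[of _ "m * K"],
      rule exI[of _ "m' / m"], intro conjI ballI allI)
    fix x x' assume "x \<in> l1" "x' \<in> l1"
    then show "\<Phi> (J (\<lambda>n. x n + x' n)) = \<Phi> (J x) + \<Phi> (J x')" by (simp add: J(2) linear_add[OF lin])
  next
    fix x r assume "x \<in> l1"
    then show "\<Phi> (J (\<lambda>n. r * x n)) = r *\<^sub>R \<Phi> (J x)" by (simp add: J(3) linear_scale[OF lin])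
  next
    fix x assume x: "x \<in> l1"
    show "m * \<delta> * l1norm x \<le> norm (\<Phi> (J x))" "norm (\<Phi> (J x)) \<le> m * K * l1norm x"
      using J(4,5)[OF x] m by (simp_all add: mult.assoc)
    show "m' / m * norm (\<Phi> (J x)) \<le> norm (T (\<Phi> (J x)))" using m m' by simp
  qed (use J(1) m m' Kop in auto)
qed

subsection \<open>Rank-one operators\<close>

definition rank_one :: "'a::real_normed_vector \<Rightarrow> ('a \<Rightarrow>\<^sub>L real) \<Rightarrow> ('a \<Rightarrow>\<^sub>L 'a)" where
  "rank_one x \<phi> = blinfun_scaleR_left x o\<^sub>L \<phi>"

lemma rank_one_apply [simp]: "blinfun_apply (rank_one x \<phi>) y = \<phi> y *\<^sub>R x"
  by (simp add: rank_one_def)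

lemma rank_one_linear_left: "linear (\<lambda>x. rank_one x \<phi>)"
  by (auto intro!: linearI blinfun_eqI simp: blinfun.bilinear_simps scaleR_add_right)

lemma rank_one_linear_right: "linear (rank_one x)"
  by (auto intro!: linearI blinfun_eqI simp: blinfun.bilinear_simps scaleR_add_left)

lemma compose_rank_one: "a o\<^sub>L rank_one x \<phi> = rank_one (a x) \<phi>"
  by (rule blinfun_eqI) (simp add: blinfun.bilinear_simps)

lemma rank_one_compose: "rank_one x \<phi> o\<^sub>L a = rank_one x (\<phi> o\<^sub>L a)"
  by (rule blinfun_eqI) simp

lemma rank_one_compose_rank_one: "rank_one x \<phi> o\<^sub>L rank_one y \<psi> = \<phi> y *\<^sub>R rank_one x \<psi>"
  by (rule blinfun_eqI) (simp add: blinfun.bilinear_simps)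

lemma norm_rank_one: "norm (rank_one x \<phi>) = norm x * norm \<phi>"
proof (rule antisym)
  show "norm (rank_one x \<phi>) \<le> norm x * norm \<phi>"
  proof (rule norm_blinfun_bound)
    fix y
    have "\<bar>\<phi> y\<bar> \<le> norm \<phi> * norm y" using norm_blinfun[of \<phi> y] by simp
    then show "norm (blinfun_apply (rank_one x \<phi>) y) \<le> norm x * norm \<phi> * norm y"
      using mult_left_mono[of "\<bar>\<phi> y\<bar>" "norm \<phi> * norm y" "norm x"] by (simp add: mult_ac)
  qed simp
  show "norm x * norm \<phi> \<le> norm (rank_one x \<phi>)"
  proof (cases "x = 0")
    case False
    have "norm \<phi> \<le> norm (rank_one x \<phi>) / norm x"
    proof (rule norm_blinfun_bound)
      fix y
      have "\<bar>\<phi> y\<bar> * norm x \<le> norm (rank_one x \<phi>) * norm y"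
        using norm_blinfun[of "rank_one x \<phi>" y] by simp
      then show "norm (blinfun_apply \<phi> y) \<le> norm (rank_one x \<phi>) / norm x * norm y"
        using False by (simp add: field_simps)
    qed simp
    then show ?thesis using False by (simp add: field_simps)
  qed simp
qed

text \<open>The image of the unit ball lies in a compact segment of the line through
  \<open>x\<close>.\<close>

lemma rank_one_Kop: "rank_one x \<phi> \<in> Kop"
proof -
  let ?K = "(\<lambda>t. t *\<^sub>R x) ` {- norm \<phi>..norm \<phi>}" and ?S = "blinfun_apply (rank_one x \<phi>) ` ball 0 1"
  have K: "compact ?K" by (intro compact_continuous_image continuous_intros) auto
  have "?S \<subseteq> ?K"
  proof
    fix z assume "z \<in> ?S"
    then obtain y where y: "norm y < 1" "z = \<phi> y *\<^sub>R x" by auto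
    have "\<bar>\<phi> y\<bar> \<le> norm \<phi> * norm y" using norm_blinfun[of \<phi> y] by simp
    also have "\<dots> \<le> norm \<phi>" using y(1) by (simp add: mult_left_le)
    finally show "z \<in> ?K" using y(2) by (intro image_eqI[of _ _ "\<phi> y"]) auto
  qed
  then have "closure ?S \<subseteq> ?K" by (rule closure_minimal) (rule compact_imp_closed[OF K])
  then have "?K \<inter> closure ?S = closure ?S" by blast
  then have "compact (closure ?S)" using compact_Int_closed[OF K closed_closure, of ?S] by simp
  then show ?thesis unfolding Kop_def by blast
qed

section \<open>Copies of l1 fixed by multiplication operators\<close>

lemma fixes_l1_Lop:
  fixes a :: "'a::banach \<Rightarrow>\<^sub>L 'a" and \<phi> :: "nat \<Rightarrow> ('a \<Rightarrow>\<^sub>L real)"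
  assumes "a \<noteq> 0" "l1_sequence \<phi>" shows "fixes_l1 (Lop a)"
proof -
  obtain z where z: "a z \<noteq> 0" using assms(1) by (metis blinfun_eqI zero_blinfun.rep_eq)
  then have "z \<noteq> 0" by (auto simp: blinfun.zero_right)
  with z show ?thesis
    by (intro fixes_l1I[OF assms(2), of "rank_one z" "norm z" "norm (a z)"])
      (auto simp: rank_one_linear_right rank_one_Kop norm_rank_one Lop_def compose_rank_one)
qed

lemma fixes_l1_Rop:
  fixes a :: "'a::banach \<Rightarrow>\<^sub>L 'a" and y :: "nat \<Rightarrow> 'a"
  assumes "a \<noteq> 0" "l1_sequence y" shows "fixes_l1 (Rop a)"
proof -
  obtain z where z: "a z \<noteq> 0" using assms(1) by (metis blinfun_eqI zero_blinfun.rep_eq)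
  \<comment> \<open>A functional that does not vanish at a z makes its composition with
    \<open>a\<close> nonzero, so both scaling factors are positive.\<close>
  obtain \<psi> where \<psi>: "blinfun_apply \<psi> (a z) = norm (a z)" using norming_functional .
  have "\<psi> \<noteq> 0" "\<psi> o\<^sub>L a \<noteq> 0"
    using z \<psi> by (auto dest: arg_cong[of _ _ "\<lambda>h. blinfun_apply h z"])
  then show ?thesis
    by (intro fixes_l1I[OF assms(2), of "\<lambda>y. rank_one y \<psi>" "norm \<psi>" "norm (\<psi> o\<^sub>L a)"])
      (auto simp: rank_one_linear_left rank_one_Kop norm_rank_one Rop_def rank_one_compose mult.commute)
qed

subsection \<open>Weakly null sequences that are not norm null\<close>

text \<open>One more functional lowers the dimension by at most one: subtracting a multiple of a
  fixed vector \<open>v\<close> with \<phi> v nonzero moves the larger common kernel into the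
  smaller one.\<close>

lemma finite_codim_infinite_dim:
  fixes \<Phi> :: "('a::real_normed_vector \<Rightarrow>\<^sub>L real) set"
  assumes "infinite_dim TYPE('a::real_normed_vector)" "finite \<Phi>"
  shows "\<nexists>B. finite B \<and> {x. \<forall>\<phi>\<in>\<Phi>. blinfun_apply \<phi> x = 0} \<subseteq> span B"
  using assms(2)
proof (induction \<Phi>)
  case empty
  show ?case using assms(1) by (simp add: infinite_dim_def top.extremum_unique)
next
  case (insert \<phi> \<Phi>)
  show ?case
  proof
    let ?V = "{x. \<forall>\<phi>\<in>\<Phi>. blinfun_apply \<phi> x = 0}"
    assume "\<exists>B. finite B \<and> {x. \<forall>\<phi>\<in>insert \<phi> \<Phi>. blinfun_apply \<phi> x = 0} \<subseteq> span B"
    then obtain B where B: "finite B" "{x. \<forall>\<phi>\<in>insert \<phi> \<Phi>. blinfun_apply \<phi> x = 0} \<subseteq> span B" by blast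
    have "\<exists>B. finite B \<and> ?V \<subseteq> span B"
    proof (cases "\<exists>v\<in>?V. blinfun_apply \<phi> v \<noteq> 0")
      case False
      then have "?V \<subseteq> span B" using B(2) by auto
      then show ?thesis using B(1) by blast
    next
      case True
      then obtain v where v: "v \<in> ?V" "blinfun_apply \<phi> v \<noteq> 0" by blast
      have "x \<in> span (insert v B)" if x: "x \<in> ?V" for x
      proof -
        let ?k = "blinfun_apply \<phi> x / blinfun_apply \<phi> v"
        have "x - ?k *\<^sub>R v \<in> span B"
          using x v by (intro subsetD[OF B(2)]) (auto simp: blinfun.bilinear_simps)
        then show ?thesis unfolding span_insert by blast
      qed
      then have "?V \<subseteq> span (insert v B)" by blast
      then show ?thesis using B(1) by (meson finite_insert)
    qed
    then show False by (rule notE[OF insert.IH])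
  qed
qed

text \<open>Evaluating at x j, respectively with \<phi> i, shows that both sequences are 1-separated.\<close>

lemma semi_biorthogonal_sequence:
  assumes "infinite_dim TYPE('a::real_normed_vector)"
  obtains x :: "nat \<Rightarrow> 'a::real_normed_vector" and \<phi> :: "nat \<Rightarrow> ('a \<Rightarrow>\<^sub>L real)"
  where "\<And>n. norm (x n) = 1" "\<And>n. norm (\<phi> n) \<le> 1" "\<And>n. blinfun_apply (\<phi> n) (x n) = 1"
    "\<And>i n. i < n \<Longrightarrow> blinfun_apply (\<phi> i) (x n) = 0"
proof -
  have ex: "\<exists>p :: 'a \<times> ('a \<Rightarrow>\<^sub>L real). norm (fst p) = 1 \<and> norm (snd p) \<le> 1 \<and> blinfun_apply (snd p) (fst p) = 1
      \<and> (\<forall>\<psi>\<in>\<Phi>. blinfun_apply \<psi> (fst p) = 0)" if "finite \<Phi>" for \<Phi> :: "('a \<Rightarrow>\<^sub>L real) set"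
  proof -
    \<comment> \<open>With the empty spanning set, infinite dimension of the common kernel says that
      it contains a nonzero vector.\<close>
    have "\<not> (finite ({} :: 'a set) \<and> {x. \<forall>\<psi>\<in>\<Phi>. blinfun_apply \<psi> x = 0} \<subseteq> span {})"
      using finite_codim_infinite_dim[OF assms that] by (rule contrapos_nn) (rule exI[of _ "{}"])
    then obtain v where v: "v \<noteq> 0" "\<forall>\<psi>\<in>\<Phi>. blinfun_apply \<psi> v = 0"
      unfolding span_empty by blast
    define u where "u = v /\<^sub>R norm v"
    have u: "norm u = 1" "\<forall>\<psi>\<in>\<Phi>. blinfun_apply \<psi> u = 0"
      using v by (auto simp: u_def blinfun.scaleR_right)
    obtain \<psi> where "norm \<psi> \<le> 1" "blinfun_apply \<psi> u = norm u" using norming_functional .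
    then show ?thesis using u by (intro exI[of _ "(u, \<psi>)"]) simp
  qed
  then have "\<forall>\<Phi> :: ('a \<Rightarrow>\<^sub>L real) set. \<exists>p :: 'a \<times> ('a \<Rightarrow>\<^sub>L real). finite \<Phi> \<longrightarrow>
      norm (fst p) = 1 \<and> norm (snd p) \<le> 1 \<and> blinfun_apply (snd p) (fst p) = 1
      \<and> (\<forall>\<psi>\<in>\<Phi>. blinfun_apply \<psi> (fst p) = 0)" by simp
  from choice[OF this] obtain S :: "('a \<Rightarrow>\<^sub>L real) set \<Rightarrow> 'a \<times> ('a \<Rightarrow>\<^sub>L real)" where
    "\<forall>\<Phi>. finite \<Phi> \<longrightarrow> norm (fst (S \<Phi>)) = 1 \<and> norm (snd (S \<Phi>)) \<le> 1
      \<and> blinfun_apply (snd (S \<Phi>)) (fst (S \<Phi>)) = 1 \<and> (\<forall>\<psi>\<in>\<Phi>. blinfun_apply \<psi> (fst (S \<Phi>)) = 0)" ..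
  then have S: "norm (fst (S \<Phi>)) = 1" "norm (snd (S \<Phi>)) \<le> 1" "blinfun_apply (snd (S \<Phi>)) (fst (S \<Phi>)) = 1"
      "\<forall>\<psi>\<in>\<Phi>. blinfun_apply \<psi> (fst (S \<Phi>)) = 0" if "finite \<Phi>" for \<Phi>
    using that by simp_all
  \<comment> \<open>\<open>F n\<close> collects the functionals chosen before stage n; the next
    vector is taken in their common kernel.\<close>
  define F where "F = rec_nat {} (\<lambda>_ \<Phi>. insert (snd (S \<Phi>)) \<Phi>)"
  have F: "F 0 = {}" "F (Suc n) = insert (snd (S (F n))) (F n)" for n by (simp_all add: F_def)
  have fin: "finite (F n)" for n by (induction n) (auto simp: F)
  have mem: "snd (S (F i)) \<in> F n" if "i < n" for i n
    using that by (induction n) (auto simp: F less_Suc_eq)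
  show ?thesis
    by (rule that[of "\<lambda>n. fst (S (F n))" "\<lambda>n. snd (S (F n))"])
      (simp_all add: S(1-3)[OF fin] bspec[OF S(4)[OF fin] mem])
qed

text \<open>Rosenthal's theorem gives only a weakly Cauchy subsequence, whose limit may exist just
  in the bidual. Differences of consecutive terms cancel it, and separation keeps them away from 0
  in norm.\<close>

lemma separated_weakly_null:
  fixes y :: "nat \<Rightarrow> 'b::real_normed_vector"
  assumes no_l1: "\<And>y :: nat \<Rightarrow> 'b. \<not> l1_sequence y"
    and bdd: "bounded (range y)" and sep: "\<And>i j. i < j \<Longrightarrow> 1 \<le> norm (y j - y i)"
  obtains z where "\<And>n. 1 \<le> norm (z n)" "\<And>g :: 'b \<Rightarrow>\<^sub>L real. (\<lambda>n. g (z n)) \<longlonglongrightarrow> 0"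
proof -
  obtain r :: "nat \<Rightarrow> nat" where r: "strict_mono r"
    "\<And>g :: 'b \<Rightarrow>\<^sub>L real. convergent (\<lambda>n. g (y (r n)))"
    by (rule rosenthal_l1[OF bdd no_l1]) (assumption | rule that)+
  show ?thesis
  proof (rule that[of "\<lambda>n. y (r (Suc n)) - y (r n)"])
    show "1 \<le> norm (y (r (Suc n)) - y (r n))" for n
      using r(1) by (intro sep) (simp add: strict_mono_Suc_iff)
    fix g :: "'b \<Rightarrow>\<^sub>L real"
    obtain l where "(\<lambda>n. g (y (r n))) \<longlonglongrightarrow> l" using r(2)[of g] by (auto simp: convergent_def)
    from tendsto_diff[OF LIMSEQ_Suc[OF this] this]
    show "(\<lambda>n. g (y (r (Suc n)) - y (r n))) \<longlonglongrightarrow> 0" by (simp add: blinfun.diff_right)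
  qed
qed

lemma weakly_null_in_space:
  assumes "infinite_dim TYPE('a::real_normed_vector)" and "\<And>y :: nat \<Rightarrow> 'a. \<not> l1_sequence y"
  obtains z :: "nat \<Rightarrow> 'a::real_normed_vector" where "\<And>n. 1 \<le> norm (z n)" "\<And>g :: 'a \<Rightarrow>\<^sub>L real. (\<lambda>n. g (z n)) \<longlonglongrightarrow> 0"
proof -
  obtain x and \<phi> :: "nat \<Rightarrow> ('a \<Rightarrow>\<^sub>L real)" where x: "\<And>n. norm (x n) = 1" "\<And>n. norm (\<phi> n) \<le> 1"
    "\<And>n. blinfun_apply (\<phi> n) (x n) = 1" "\<And>i n. i < n \<Longrightarrow> blinfun_apply (\<phi> i) (x n) = 0"
    by (rule semi_biorthogonal_sequence[OF assms(1)]) (assumption | rule that)+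
  have sep: "1 \<le> norm (x j - x i)" if "i < j" for i j
  proof -
    have "1 = norm (blinfun_apply (\<phi> i) (x j - x i))" using x(3)[of i] x(4)[OF that] by (simp add: blinfun.diff_right)
    also have "\<dots> \<le> norm (\<phi> i) * norm (x j - x i)" by (rule norm_blinfun)
    also have "\<dots> \<le> norm (x j - x i)" using x(2) by (simp add: mult_left_le_one_le)
    finally show ?thesis .
  qed
  have bdd: "bounded (range x)" using x(1) by (auto simp: bounded_iff intro: exI[of _ 1])
  show ?thesis
    by (rule separated_weakly_null[OF assms(2) bdd sep]) (assumption | rule that)+
qed

lemma weakly_null_in_dual:
  assumes "infinite_dim TYPE('a::real_normed_vector)" and "\<And>y :: nat \<Rightarrow> ('a \<Rightarrow>\<^sub>L real). \<not> l1_sequence y"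
  obtains z :: "nat \<Rightarrow> ('a::real_normed_vector \<Rightarrow>\<^sub>L real)" where "\<And>n. 1 \<le> norm (z n)"
    "\<And>g :: ('a \<Rightarrow>\<^sub>L real) \<Rightarrow>\<^sub>L real. (\<lambda>n. g (z n)) \<longlonglongrightarrow> 0"
proof -
  obtain x and \<phi> :: "nat \<Rightarrow> ('a \<Rightarrow>\<^sub>L real)" where x: "\<And>n. norm (x n) = 1" "\<And>n. norm (\<phi> n) \<le> 1"
    "\<And>n. blinfun_apply (\<phi> n) (x n) = 1" "\<And>i n. i < n \<Longrightarrow> blinfun_apply (\<phi> i) (x n) = 0"
    by (rule semi_biorthogonal_sequence[OF assms(1)]) (assumption | rule that)+
  have sep: "1 \<le> norm (\<phi> j - \<phi> i)" if "i < j" for i j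
    using norm_blinfun[of "\<phi> j - \<phi> i" "x j"] x(1)[of j] x(3)[of j] x(4)[OF that]
    by (simp add: blinfun.diff_left)
  have bdd: "bounded (range \<phi>)" using x(2) by (auto simp: bounded_iff)
  show ?thesis
    by (rule separated_weakly_null[OF assms(2) bdd sep]) (assumption | rule that)+
qed

subsection \<open>Functionals in lcc, rcc and wpL vanish on rank-one operators\<close>

lemma dualA_bound:
  assumes "f \<in> dualA"
  obtains C where "C \<ge> 0" "\<And>x. x \<in> Kop \<Longrightarrow> \<bar>f x\<bar> \<le> C * norm x"
proof -
  obtain C where C: "\<And>x. x \<in> Kop \<Longrightarrow> \<bar>f x\<bar> \<le> C * norm x" using assms unfolding dualA_def by blast
  show ?thesis
  proof (rule that[of "\<bar>C\<bar>"])
    show "\<bar>f x\<bar> \<le> \<bar>C\<bar> * norm x" if "x \<in> Kop" for x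
      using C[OF that] by (meson abs_ge_self mult_right_mono norm_ge_zero order_trans)
  qed simp
qed

lemma dualA_scale: "f \<in> dualA \<Longrightarrow> x \<in> Kop \<Longrightarrow> f (c *\<^sub>R x) = c * f x"
  by (simp add: dualA_def)

text \<open>Pulling f back along one factor of x \<otimes> \<phi> turns it into a bounded functional
  on X or X*, so that weak convergence there passes to rank-one operators in A.\<close>

lemma dualA_bounded_linear:
  assumes f: "f \<in> dualA" and lin: "linear \<Phi>" and Kop: "\<And>u. \<Phi> u \<in> Kop"
    and m: "\<And>u. norm (\<Phi> u) = m * norm u"
  shows "bounded_linear (\<lambda>u. f (\<Phi> u))"
proof -
  obtain C where C: "\<And>x. x \<in> Kop \<Longrightarrow> \<bar>f x\<bar> \<le> C * norm x" using dualA_bound[OF f] by metis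
  show ?thesis
  proof (rule bounded_linear_intro[where K = "C * m"])
    show "f (\<Phi> (u + v)) = f (\<Phi> u) + f (\<Phi> v)" for u v
      using f Kop by (simp add: linear_add[OF lin] dualA_def)
    show "f (\<Phi> (r *\<^sub>R u)) = r *\<^sub>R f (\<Phi> u)" for r u
      using f Kop by (simp add: linear_scale[OF lin] dualA_def)
    show "norm (f (\<Phi> u)) \<le> norm u * (C * m)" for u
      using C[OF Kop[of u]] by (simp add: m algebra_simps)
  qed
qed

lemma dualA_rank_one_left:
  assumes "f \<in> dualA"
  obtains g :: "'a::real_normed_vector \<Rightarrow>\<^sub>L real" where "\<And>x. f (rank_one x \<phi>) = g x"
proof -
  have "bounded_linear (\<lambda>x. f (rank_one x \<phi>))"
    by (rule dualA_bounded_linear[OF assms rank_one_linear_left rank_one_Kop, where m = "norm \<phi>"])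
      (simp add: norm_rank_one)
  then show ?thesis
    by (intro that[of "Blinfun (\<lambda>x. f (rank_one x \<phi>))"]) (simp add: bounded_linear_Blinfun_apply)
qed

lemma dualA_rank_one_right:
  fixes x :: "'a::real_normed_vector"
  assumes "f \<in> dualA"
  obtains g :: "('a \<Rightarrow>\<^sub>L real) \<Rightarrow>\<^sub>L real" where "\<And>\<phi>. f (rank_one x \<phi>) = g \<phi>"
proof -
  have "bounded_linear (\<lambda>\<phi>. f (rank_one x \<phi>))"
    by (rule dualA_bounded_linear[OF assms rank_one_linear_right rank_one_Kop norm_rank_one])
  then show ?thesis
    by (intro that[of "Blinfun (\<lambda>\<phi>. f (rank_one x \<phi>))"]) (simp add: bounded_linear_Blinfun_apply)
qed

lemma weakly_null_rank_one_left:
  fixes z :: "nat \<Rightarrow> 'a::real_normed_vector"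
  assumes "\<And>g :: 'a \<Rightarrow>\<^sub>L real. (\<lambda>n. g (z n)) \<longlonglongrightarrow> 0"
  shows "weakly_null (\<lambda>n. rank_one (z n) \<phi>)"
  unfolding weakly_null_def
proof (intro conjI allI ballI)
  fix f assume "f \<in> (dualA :: (('a \<Rightarrow>\<^sub>L 'a) \<Rightarrow> real) set)"
  then obtain g :: "'a \<Rightarrow>\<^sub>L real" where "\<And>x. f (rank_one x \<phi>) = g x"
    by (rule dualA_rank_one_left) (assumption | rule that)+
  then show "(\<lambda>n. f (rank_one (z n) \<phi>)) \<longlonglongrightarrow> 0" using assms by simp
qed (rule rank_one_Kop)

lemma weakly_null_rank_one_right:
  fixes z :: "nat \<Rightarrow> ('a::real_normed_vector \<Rightarrow>\<^sub>L real)"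
  assumes "\<And>g :: ('a \<Rightarrow>\<^sub>L real) \<Rightarrow>\<^sub>L real. (\<lambda>n. g (z n)) \<longlonglongrightarrow> 0"
  shows "weakly_null (\<lambda>n. rank_one x (z n))"
  unfolding weakly_null_def
proof (intro conjI allI ballI)
  fix f assume "f \<in> (dualA :: (('a \<Rightarrow>\<^sub>L 'a) \<Rightarrow> real) set)"
  then obtain g :: "('a \<Rightarrow>\<^sub>L real) \<Rightarrow>\<^sub>L real" where "\<And>\<phi>. f (rank_one x \<phi>) = g \<phi>"
    by (rule dualA_rank_one_right) (assumption | rule that)+
  then show "(\<lambda>n. f (rank_one x (z n))) \<longlonglongrightarrow> 0" using assms by simp
qed (rule rank_one_Kop)

section \<open>Lower bounds for the dual norms of fa and af\<close>

lemma dual_norm_ge: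
  assumes "\<And>x. x \<in> Kop \<Longrightarrow> \<bar>g x\<bar> \<le> C * norm x" "C \<ge> 0" and b: "b \<in> Kop" "norm b \<le> 1"
  shows "\<bar>g b\<bar> \<le> dual_norm g"
  unfolding dual_norm_def
proof (rule cSUP_upper)
  show "bdd_above ((\<lambda>x. \<bar>g x\<bar>) ` {x \<in> Kop. norm x \<le> 1})"
  proof (rule bdd_aboveI2)
    fix x :: "'a \<Rightarrow>\<^sub>L 'a" assume x: "x \<in> {x \<in> Kop. norm x \<le> 1}"
    then have "\<bar>g x\<bar> \<le> C * norm x" using assms(1) by blast
    also have "\<dots> \<le> C" using x assms(2) by (simp add: mult_left_le)
    finally show "\<bar>g x\<bar> \<le> C" .
  qed
qed (use b in auto)

lemma dual_norm_lmod_ge: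
  assumes f: "f \<in> dualA" and b: "b \<in> Kop" "norm b \<le> 1"
  shows "\<bar>f (rank_one x \<phi> o\<^sub>L b)\<bar> \<le> dual_norm (lmod f (rank_one x \<phi>))"
proof -
  obtain C where C: "C \<ge> 0" "\<And>x. x \<in> Kop \<Longrightarrow> \<bar>f x\<bar> \<le> C * norm x" using dualA_bound[OF f] by metis
  have "\<bar>lmod f (rank_one x \<phi>) y\<bar> \<le> C * norm (rank_one x \<phi>) * norm y" for y
  proof -
    \<comment> \<open>The product is again rank-one, which places it in \<open>Kop\<close>, where
      the bound on f applies.\<close>
    have "\<bar>f (rank_one x \<phi> o\<^sub>L y)\<bar> \<le> C * norm (rank_one x \<phi> o\<^sub>L y)"
      by (intro C(2)) (simp add: rank_one_compose rank_one_Kop)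
    also have "\<dots> \<le> C * (norm (rank_one x \<phi>) * norm y)"
      by (intro mult_left_mono norm_blinfun_compose C(1))
    finally show ?thesis by (simp add: lmod_def mult.assoc)
  qed
  then have "\<bar>lmod f (rank_one x \<phi>) b\<bar> \<le> dual_norm (lmod f (rank_one x \<phi>))"
    using C(1) b by (intro dual_norm_ge[where C = "C * norm (rank_one x \<phi>)"]) auto
  then show ?thesis by (simp add: lmod_def)
qed

lemma dual_norm_rmod_ge:
  assumes f: "f \<in> dualA" and b: "b \<in> Kop" "norm b \<le> 1"
  shows "\<bar>f (b o\<^sub>L rank_one x \<phi>)\<bar> \<le> dual_norm (rmod (rank_one x \<phi>) f)"
proof -
  obtain C where C: "C \<ge> 0" "\<And>x. x \<in> Kop \<Longrightarrow> \<bar>f x\<bar> \<le> C * norm x" using dualA_bound[OF f] by metis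
  have "\<bar>rmod (rank_one x \<phi>) f y\<bar> \<le> C * norm (rank_one x \<phi>) * norm y" for y
  proof -
    have "\<bar>f (y o\<^sub>L rank_one x \<phi>)\<bar> \<le> C * norm (y o\<^sub>L rank_one x \<phi>)"
      by (intro C(2)) (simp add: compose_rank_one rank_one_Kop)
    also have "\<dots> \<le> C * (norm y * norm (rank_one x \<phi>))"
      by (intro mult_left_mono norm_blinfun_compose C(1))
    finally show ?thesis by (simp add: rmod_def mult_ac)
  qed
  then have "\<bar>rmod (rank_one x \<phi>) f b\<bar> \<le> dual_norm (rmod (rank_one x \<phi>) f)"
    using C(1) b by (intro dual_norm_ge[where C = "C * norm (rank_one x \<phi>)"]) auto
  then show ?thesis by (simp add: rmod_def)
qed

text \<open>The norm of a functional need not be attained, so 1/2 stands for any number below 1: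
  smaller values on the whole unit ball would push the norm down to 1/2.\<close>

lemma almost_norming_vector:
  fixes \<phi> :: "'a::real_normed_vector \<Rightarrow>\<^sub>L real"
  assumes "1 \<le> norm \<phi>"
  obtains y where "norm y \<le> 1" "1/2 \<le> \<bar>blinfun_apply \<phi> y\<bar>"
proof (rule ccontr)
  assume neg: "\<not> thesis"
  have "norm \<phi> \<le> 1/2"
  proof (rule norm_blinfun_bound)
    fix y
    show "norm (blinfun_apply \<phi> y) \<le> 1/2 * norm y"
    proof (cases "y = 0")
      case False
      have "\<bar>blinfun_apply \<phi> (y /\<^sub>R norm y)\<bar> < 1/2"
        using that[of "y /\<^sub>R norm y"] neg False by force
      then show ?thesis using False by (simp add: blinfun.scaleR_right abs_mult field_simps)
    qed (simp add: blinfun.zero_right)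
  qed simp
  then show False using assms by simp
qed

text \<open>For a = x \<otimes> z_n and y almost norming for z_n, the value of fa at y \<otimes>
  \<psi> is z_n(y) f(x \<otimes> \<psi>), of modulus at least half of that of f(x \<otimes> \<psi>).
  The bound on \<psi> keeps the test operator in the unit ball, so the norms of fa stay above this
  constant.\<close>

lemma lcc_rank_one:
  fixes x :: "'a::real_normed_vector"
  assumes inf: "infinite_dim TYPE('a::real_normed_vector)" and no_l1: "\<And>y :: nat \<Rightarrow> ('a \<Rightarrow>\<^sub>L real). \<not> l1_sequence y"
    and f: "f \<in> lcc" and \<psi>: "norm \<psi> \<le> 1"
  shows "f (rank_one x \<psi>) = 0"
proof -
  have fA: "f \<in> dualA" using f by (simp add: lcc_def)
  obtain z :: "nat \<Rightarrow> ('a \<Rightarrow>\<^sub>L real)" where z: "\<And>n. 1 \<le> norm (z n)"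
    "\<And>g :: ('a \<Rightarrow>\<^sub>L real) \<Rightarrow>\<^sub>L real. (\<lambda>n. g (z n)) \<longlonglongrightarrow> 0"
    by (rule weakly_null_in_dual[OF inf no_l1]) (assumption | rule that)+
  have "(\<lambda>n. dual_norm (lmod f (rank_one x (z n)))) \<longlonglongrightarrow> 0"
    using f weakly_null_rank_one_right[OF z(2)] by (auto simp: lcc_def)
  moreover have "\<bar>f (rank_one x \<psi>)\<bar> / 2 \<le> dual_norm (lmod f (rank_one x (z n)))" for n
  proof -
    obtain y where y: "norm y \<le> 1" "1/2 \<le> \<bar>blinfun_apply (z n) y\<bar>"
      using almost_norming_vector[OF z(1)] .
    have "\<bar>f (rank_one x \<psi>)\<bar> / 2 \<le> \<bar>blinfun_apply (z n) y\<bar> * \<bar>f (rank_one x \<psi>)\<bar>"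
      using mult_right_mono[OF y(2), of "\<bar>f (rank_one x \<psi>)\<bar>"] by simp
    also have "\<dots> = \<bar>f (rank_one x (z n) o\<^sub>L rank_one y \<psi>)\<bar>"
      by (simp add: rank_one_compose_rank_one dualA_scale[OF fA rank_one_Kop] abs_mult)
    also have "\<dots> \<le> dual_norm (lmod f (rank_one x (z n)))"
      using y(1) \<psi> by (intro dual_norm_lmod_ge[OF fA rank_one_Kop]) (simp add: norm_rank_one mult_le_one)
    finally show ?thesis .
  qed
  ultimately have "\<bar>f (rank_one x \<psi>)\<bar> / 2 \<le> 0" by (intro LIMSEQ_le_const) auto
  then show ?thesis by simp
qed

text \<open>Mirror image: af for a = z_n \<otimes> \<psi> is tested on x \<otimes> \<phi>. Vectors
  have exact norming functionals, so no factor 1/2 is lost.\<close>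

lemma rcc_rank_one:
  fixes x :: "'a::real_normed_vector"
  assumes inf: "infinite_dim TYPE('a::real_normed_vector)" and no_l1: "\<And>y :: nat \<Rightarrow> 'a. \<not> l1_sequence y"
    and f: "f \<in> rcc" and x: "norm x \<le> 1"
  shows "f (rank_one x \<psi>) = 0"
proof -
  have fA: "f \<in> dualA" using f by (simp add: rcc_def)
  obtain z :: "nat \<Rightarrow> 'a" where z: "\<And>n. 1 \<le> norm (z n)"
    "\<And>g :: 'a \<Rightarrow>\<^sub>L real. (\<lambda>n. g (z n)) \<longlonglongrightarrow> 0"
    by (rule weakly_null_in_space[OF inf no_l1]) (assumption | rule that)+
  have "(\<lambda>n. dual_norm (rmod (rank_one (z n) \<psi>) f)) \<longlonglongrightarrow> 0"
    using f weakly_null_rank_one_left[OF z(2)] by (auto simp: rcc_def)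
  moreover have "\<bar>f (rank_one x \<psi>)\<bar> \<le> dual_norm (rmod (rank_one (z n) \<psi>) f)" for n
  proof -
    obtain \<phi> where \<phi>: "norm \<phi> \<le> 1" "blinfun_apply \<phi> (z n) = norm (z n)" using norming_functional .
    have "\<bar>f (rank_one x \<psi>)\<bar> \<le> \<bar>blinfun_apply \<phi> (z n)\<bar> * \<bar>f (rank_one x \<psi>)\<bar>"
      using mult_right_mono[OF z(1)[of n], of "\<bar>f (rank_one x \<psi>)\<bar>"] \<phi>(2) by simp
    also have "\<dots> = \<bar>f (rank_one x \<phi> o\<^sub>L rank_one (z n) \<psi>)\<bar>"
      by (simp add: rank_one_compose_rank_one dualA_scale[OF fA rank_one_Kop] abs_mult)
    also have "\<dots> \<le> dual_norm (rmod (rank_one (z n) \<psi>) f)"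
      using x \<phi> by (intro dual_norm_rmod_ge[OF fA rank_one_Kop]) (simp add: norm_rank_one mult_le_one)
    finally show ?thesis .
  qed
  ultimately have "\<bar>f (rank_one x \<psi>)\<bar> \<le> 0" by (intro LIMSEQ_le_const) auto
  then show ?thesis by simp
qed

lemma weakly_precompact_rank_one_ball:
  fixes x :: "'a::real_normed_vector"
  assumes no_l1: "\<And>y :: nat \<Rightarrow> ('a \<Rightarrow>\<^sub>L real). \<not> l1_sequence y"
  shows "weakly_precompact (rank_one x ` cball 0 1)"
  unfolding weakly_precompact_def
proof (intro conjI allI impI)
  show "rank_one x ` cball 0 1 \<subseteq> Kop" using rank_one_Kop by auto
  fix s :: "nat \<Rightarrow> ('a \<Rightarrow>\<^sub>L 'a)" assume "\<forall>n. s n \<in> rank_one x ` cball 0 1"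
  then have "\<forall>n. \<exists>\<phi>. norm \<phi> \<le> 1 \<and> s n = rank_one x \<phi>" by (metis imageE mem_cball_0)
  then obtain \<phi> where \<phi>: "\<And>n. norm (\<phi> n) \<le> 1" "\<And>n. s n = rank_one x (\<phi> n)" by metis
  have "bounded (range \<phi>)" using \<phi>(1) by (auto simp: bounded_iff)
  then obtain r :: "nat \<Rightarrow> nat" where r: "strict_mono r"
    "\<And>g :: ('a \<Rightarrow>\<^sub>L real) \<Rightarrow>\<^sub>L real. convergent (\<lambda>n. g (\<phi> (r n)))"
    by (rule rosenthal_l1[OF _ no_l1]) (assumption | rule that)+
  have "convergent (\<lambda>n. f (s (r n)))" if f: "f \<in> dualA" for f
  proof -
    obtain g :: "('a \<Rightarrow>\<^sub>L real) \<Rightarrow>\<^sub>L real" where "\<And>\<phi>. f (rank_one x \<phi>) = g \<phi>"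
      by (rule dualA_rank_one_right[OF f]) (assumption | rule that)+
    then show ?thesis using r(2)[of g] by (simp add: \<phi>(2))
  qed
  then show "\<exists>r::nat \<Rightarrow> nat. strict_mono r \<and> (\<forall>f\<in>dualA. convergent (\<lambda>n. f (s (r n))))"
    using r(1) by blast
qed

text \<open>\<open>no_l1'\<close> makes the operators x \<otimes> \<phi> a weakly precompact set,
  \<open>no_l1\<close> supplies the weakly null sequence z_n \<otimes> \<psi>. An L-set gives
  smallness uniformly in \<phi>, so \<phi> may be chosen after n, norming for z_n; the value is then
  at least the modulus of f(x \<otimes> \<psi>), against a bound of half of it.\<close>

lemma wpL_rank_one:
  fixes x :: "'a::real_normed_vector"
  assumes inf: "infinite_dim TYPE('a::real_normed_vector)" and no_l1: "\<And>y :: nat \<Rightarrow> 'a. \<not> l1_sequence y"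
    and no_l1': "\<And>y :: nat \<Rightarrow> ('a \<Rightarrow>\<^sub>L real). \<not> l1_sequence y" and f: "f \<in> wpL"
  shows "f (rank_one x \<psi>) = 0"
proof (rule ccontr)
  assume nz: "f (rank_one x \<psi>) \<noteq> 0"
  have fA: "f \<in> dualA" using f by (simp add: wpL_def)
  obtain z :: "nat \<Rightarrow> 'a" where z: "\<And>n. 1 \<le> norm (z n)"
    "\<And>g :: 'a \<Rightarrow>\<^sub>L real. (\<lambda>n. g (z n)) \<longlonglongrightarrow> 0"
    by (rule weakly_null_in_space[OF inf no_l1]) (assumption | rule that)+
  have "L_set (lmod f ` rank_one x ` cball 0 1)"
    using f weakly_precompact_rank_one_ball[OF no_l1'] by (auto simp: wpL_def)
  then have "eventually (\<lambda>n. \<forall>g\<in>lmod f ` rank_one x ` cball 0 1.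
      \<bar>g (rank_one (z n) \<psi>)\<bar> \<le> \<bar>f (rank_one x \<psi>)\<bar> / 2) sequentially"
    using weakly_null_rank_one_left[OF z(2)] nz unfolding L_set_def by (meson half_gt_zero zero_less_abs_iff)
  then obtain n where "\<forall>g\<in>lmod f ` rank_one x ` cball 0 1. \<bar>g (rank_one (z n) \<psi>)\<bar> \<le> \<bar>f (rank_one x \<psi>)\<bar> / 2"
    unfolding eventually_sequentially by blast
  then have n: "\<bar>f (rank_one x \<phi> o\<^sub>L rank_one (z n) \<psi>)\<bar> \<le> \<bar>f (rank_one x \<psi>)\<bar> / 2" if "norm \<phi> \<le> 1" for \<phi>
    using that by (simp add: lmod_def)
  obtain \<phi> where \<phi>: "norm \<phi> \<le> 1" "blinfun_apply \<phi> (z n) = norm (z n)" using norming_functional .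
  have "norm (z n) * \<bar>f (rank_one x \<psi>)\<bar> \<le> \<bar>f (rank_one x \<psi>)\<bar> / 2"
    using n[OF \<phi>(1)]
    by (simp add: rank_one_compose_rank_one dualA_scale[OF fA rank_one_Kop] abs_mult \<phi>(2))
  moreover have "\<bar>f (rank_one x \<psi>)\<bar> \<le> norm (z n) * \<bar>f (rank_one x \<psi>)\<bar>"
    using mult_right_mono[OF z(1)[of n], of "\<bar>f (rank_one x \<psi>)\<bar>"] by simp
  ultimately show False using nz by simp
qed

section \<open>Failure of separation, and the three conclusions\<close>

lemma not_separates:
  assumes inf: "infinite_dim TYPE('a::real_normed_vector)"
    and vanish: "\<And>f (x :: 'a) \<psi>. f \<in> S \<Longrightarrow> norm x \<le> 1 \<Longrightarrow> norm \<psi> \<le> 1 \<Longrightarrow> f (rank_one x \<psi>) = 0"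
  shows "\<not> separates S"
proof
  assume sep: "separates S"
  obtain x :: "nat \<Rightarrow> 'a" and \<phi> :: "nat \<Rightarrow> ('a \<Rightarrow>\<^sub>L real)" where x: "\<And>n. norm (x n) = 1" "\<And>n. norm (\<phi> n) \<le> 1"
    "\<And>n. blinfun_apply (\<phi> n) (x n) = 1" "\<And>i n. i < n \<Longrightarrow> blinfun_apply (\<phi> i) (x n) = 0"
    by (rule semi_biorthogonal_sequence[OF inf]) (assumption | rule that)+
  \<comment> \<open>The witness is a nonzero rank-one operator with both factors in the unit balls,
    where the vanishing hypothesis applies.\<close>
  have "blinfun_apply (rank_one (x 0) (\<phi> 0)) (x 0) \<noteq> 0" using x(1)[of 0] x(3)[of 0] by auto
  then have "rank_one (x 0) (\<phi> 0) \<noteq> 0" by (metis blinfun.zero_left)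
  then obtain f where "f \<in> S" "f (rank_one (x 0) (\<phi> 0)) \<noteq> 0"
    using sep rank_one_Kop unfolding separates_def by blast
  then show False using vanish[of f "x 0" "\<phi> 0"] x(1,2) by simp
qed

theorem mainTheorem11:
  assumes "infinite_dim TYPE('a::banach)"
    and "approx_prop TYPE('a)"
  shows "(separates (wpL :: (('a \<Rightarrow>\<^sub>L 'a) \<Rightarrow> real) set) \<longrightarrow>
            (\<forall>a\<in>(Kop :: ('a \<Rightarrow>\<^sub>L 'a) set). a \<noteq> 0 \<longrightarrow> fixes_l1 (Lop a))
          \<or> (\<forall>a\<in>(Kop :: ('a \<Rightarrow>\<^sub>L 'a) set). a \<noteq> 0 \<longrightarrow> fixes_l1 (Rop a)))
       \<and> (separates (lcc :: (('a \<Rightarrow>\<^sub>L 'a) \<Rightarrow> real) set) \<longrightarrow>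
            (\<forall>a\<in>(Kop :: ('a \<Rightarrow>\<^sub>L 'a) set). a \<noteq> 0 \<longrightarrow> fixes_l1 (Lop a)))
       \<and> (separates (rcc :: (('a \<Rightarrow>\<^sub>L 'a) \<Rightarrow> real) set) \<longrightarrow>
            (\<forall>a\<in>(Kop :: ('a \<Rightarrow>\<^sub>L 'a) set). a \<noteq> 0 \<longrightarrow> fixes_l1 (Rop a)))"
proof -
  \<comment> \<open>Neither alternative mentions \<open>a\<close>: whether l1 embeds in X* or in X
    is settled once, so the same side of the disjunction serves every nonzero
    \<open>a\<close>.\<close>
  let ?dual_l1 = "\<exists>\<phi> :: nat \<Rightarrow> ('a \<Rightarrow>\<^sub>L real). l1_sequence \<phi>"
  let ?space_l1 = "\<exists>y :: nat \<Rightarrow> 'a. l1_sequence y"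
  have L: "fixes_l1 (Lop a)" if "?dual_l1" "a \<noteq> 0" for a :: "'a \<Rightarrow>\<^sub>L 'a"
    using that by (auto intro: fixes_l1_Lop)
  have R: "fixes_l1 (Rop a)" if "?space_l1" "a \<noteq> 0" for a :: "'a \<Rightarrow>\<^sub>L 'a"
    using that by (auto intro: fixes_l1_Rop)
  have "?dual_l1 \<or> ?space_l1" if "separates (wpL :: (('a \<Rightarrow>\<^sub>L 'a) \<Rightarrow> real) set)"
  proof (rule ccontr)
    assume "\<not> (?dual_l1 \<or> ?space_l1)"
    then have "\<not> separates (wpL :: (('a \<Rightarrow>\<^sub>L 'a) \<Rightarrow> real) set)"
      by (intro not_separates[OF assms(1)] wpL_rank_one[OF assms(1)]) auto
    with that show False by contradiction
  qed
  moreover have "?dual_l1" if "separates (lcc :: (('a \<Rightarrow>\<^sub>L 'a) \<Rightarrow> real) set)"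
  proof (rule ccontr)
    assume "\<not> ?dual_l1"
    then have "\<not> separates (lcc :: (('a \<Rightarrow>\<^sub>L 'a) \<Rightarrow> real) set)"
      by (intro not_separates[OF assms(1)] lcc_rank_one[OF assms(1)]) auto
    with that show False by contradiction
  qed
  moreover have "?space_l1" if "separates (rcc :: (('a \<Rightarrow>\<^sub>L 'a) \<Rightarrow> real) set)"
  proof (rule ccontr)
    assume "\<not> ?space_l1"
    then have "\<not> separates (rcc :: (('a \<Rightarrow>\<^sub>L 'a) \<Rightarrow> real) set)"
      by (intro not_separates[OF assms(1)] rcc_rank_one[OF assms(1)]) auto
    with that show False by contradiction
  qed
  ultimately show ?thesis using L R by blast
qed

end
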